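(* (i) For every fixed integer $s\ge 2$ and every fixed integer $t\ge 1$, \[ \alpha_s(H_{2t}(n)) \ge \left(\frac{s-1}{t+1}+o(1)\right)\frac{2^n}{n^{t}} \qquad \text{as } n\to\infty. \] (ii) For every fixed integer $s\ge 2$, every fixed integer $t \ge 1$ and every fixed positive integer $k$, along the subsequence $n = 2^m - k$ (as $m\to\infty$) we have \[ \alpha_s(H_{2t}(n)) \ge \left(s-1+o(1)\right)\frac{2^n}{n^{t}}. \]
   Context: For an integer $r\ge1$, $H_r(n)$ is the graph with vertex set $\{0,1\}^n$ in which $x,y$ are adjacent iff their Hamming distance $|\{i : x_i\ne y_i\}|$ is exactly $r$. For a graph $G$, $\alpha_s(G)$ denotes the maximum size of a vertex set $S\subseteq V(G)$ such that the induced subgraph $G[S]$ contains no copy of $K_s$. *)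

theory Defs
  imports
    "Graph_Theory.Graph_Theory"
    "HOL-Library.Landau_Symbols"
begin

definition binary_cube :: "nat \<Rightarrow> (nat \<Rightarrow> nat) set" where
  "binary_cube n = ({..<n} \<rightarrow>\<^sub>E {0, 1})"

definition hamming_dist :: "nat \<Rightarrow> (nat \<Rightarrow> nat) \<Rightarrow> (nat \<Rightarrow> nat) \<Rightarrow> nat" where
  "hamming_dist n x y = card {i \<in> {..<n}. x i \<noteq> y i}"

text \<open>As usual in Graph_Theory, an undirected graph is a symmetric digraph without loops
  and without parallel arcs.\<close>

definition hamming_graph :: "nat \<Rightarrow> nat \<Rightarrow> (nat \<Rightarrow> nat) pair_pre_digraph" where
  "hamming_graph r n =
     \<lparr> pverts = binary_cube n,
       parcs = {(x, y). x \<in> binary_cube n \<and> y \<in> binary_cube n \<and> hamming_dist n x y = r} \<rparr>"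

definition contains_clique :: "nat \<Rightarrow> ('a, 'b) pre_digraph \<Rightarrow> bool" where
  "contains_clique s G \<longleftrightarrow> (\<exists>H. subgraph H G \<and> complete_digraph s H)"

text \<open>Meaningful for a finite graph \<open>G\<close> and \<open>s \<ge> 1\<close>; for \<open>s = 0\<close> no vertex set qualifies
  and the value is the unspecified maximum of the empty set.\<close>

definition clique_free_number :: "nat \<Rightarrow> ('a, 'b) pre_digraph \<Rightarrow> nat" (\<open>\<alpha>\<^bsub>_\<^esub>\<close>) where
  "clique_free_number s G =
     Max {card S | S. S \<subseteq> verts G \<and> \<not> contains_clique s (G \<restriction> S)}"

lemma finite_binary_cube: "finite (binary_cube n)"
  by (simp add: binary_cube_def finite_PiE)

lemma card_binary_cube: "card (binary_cube n) = 2 ^ n"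
  by (simp add: binary_cube_def card_PiE numeral_2_eq_2)

lemma hamming_dist_commute: "hamming_dist n x y = hamming_dist n y x"
  unfolding hamming_dist_def by (metis (lifting))

lemma graph_hamming_graph:
  assumes "r \<ge> 1"
  shows "graph (with_proj (hamming_graph r n))"
proof -
  have "parcs (hamming_graph r n) \<subseteq> binary_cube n \<times> binary_cube n"
    by (auto simp: hamming_graph_def)
  then have "finite (parcs (hamming_graph r n))"
    by (meson finite_SigmaI finite_binary_cube finite_subset)
  moreover have "hamming_dist n x x = 0" for x
    by (simp add: hamming_dist_def)
  moreover have "sym (parcs (hamming_graph r n))"
    by (auto simp: hamming_graph_def hamming_dist_commute intro!: symI)
  ultimately interpret pair_graph "hamming_graph r n"
    using assms
    by unfold_locales (auto simp: hamming_graph_def finite_binary_cube symmetric_def)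
  show ?thesis by unfold_locales
qed

lemma clique_free_number_attained:
  assumes "finite (verts G)" and "s \<ge> 1"
  shows "\<exists>S \<subseteq> verts G. \<not> contains_clique s (G \<restriction> S) \<and> card S = \<alpha>\<^bsub>s\<^esub> G"
    and "\<And>S. S \<subseteq> verts G \<Longrightarrow> \<not> contains_clique s (G \<restriction> S) \<Longrightarrow> card S \<le> \<alpha>\<^bsub>s\<^esub> G"
proof -
  let ?M = "{card S | S. S \<subseteq> verts G \<and> \<not> contains_clique s (G \<restriction> S)}"
  have "?M \<subseteq> card ` Pow (verts G)" by auto
  then have fin: "finite ?M" using assms(1) by (meson finite_Pow_iff finite_imageI finite_subset)
  have "\<not> contains_clique s (G \<restriction> {})"
    using assms(2) by (auto simp: contains_clique_def subgraph_def complete_digraph_def)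
  then have "?M \<noteq> {}" by blast
  from Max_in[OF fin this]
  show "\<exists>S \<subseteq> verts G. \<not> contains_clique s (G \<restriction> S) \<and> card S = \<alpha>\<^bsub>s\<^esub> G"
    unfolding clique_free_number_def by auto
  show "card S \<le> \<alpha>\<^bsub>s\<^esub> G" if "S \<subseteq> verts G" "\<not> contains_clique s (G \<restriction> S)" for S
    unfolding clique_free_number_def using that by (intro Max_ge[OF fin]) blast
qed

end

theory Submission
  imports
    Defs
    "HOL-Complex_Analysis.Complex_Analysis"
    "HOL-Number_Theory.Prime_Powers"
    "HOL-Number_Theory.Cong"
    "HOL-Probability.Sinc_Integral"
    "HOL-Real_Asymp.Real_Asymp"
    "HOL-Algebra.Algebraic_Closure_Type"
    "HOL-Library.Z2"
begin

text \<open>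
  A colouring of the cube with \<open>N\<close> colours in which words at distance \<open>2t\<close> always get different colours
  gives a \<open>K\<^sub>s\<close>-free set of size at least \<open>(s - 1) 2^n / N\<close>: take the \<open>s - 1\<close> largest colour classes.

  For \<open>n = 2^m - k\<close> label the coordinates by nonzero elements of the field with \<open>2^m\<close> elements and colour
  a word by the odd power sums of degree below \<open>2t\<close> of the labels in its support (the syndrome of a BCH
  code); this uses \<open>2^(m t)\<close> colours.

  For general \<open>n\<close> take a prime \<open>p > n\<close> and colour by the first \<open>t\<close> elementary symmetric functions modulo
  \<open>p\<close> of the labels in the support, together with half the weight modulo \<open>t + 1\<close>.  The latter forces
  two words of one colour at distance \<open>2t\<close> to have equal weights, so both differences of the supports have
  \<open>t\<close> elements and the same elementary symmetric functions, hence coincide.  This uses \<open>(t + 1) p^t\<close>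
  colours, so a prime \<open>p = (1 + o(1)) n\<close> is needed.

  Such primes come from the non-vanishing of the zeta function on the line \<open>Re s = 1\<close> by a Wiener-Ikehara
  argument: smoothing with the Fejer kernel \<open>K\<^sub>T\<close> gives \<open>\<Sum>n. \<Lambda>(n)/n K\<^sub>T(ln n - y) \<longlonglongrightarrow> 2\<pi>\<close> as \<open>y\<close> tends to
  infinity for every \<open>T\<close>, whereas the part of the sum outside a fixed window around \<open>y\<close> is \<open>O(1/T)\<close>.
\<close>

hide_const (open) Divisibility.prime Polynomials.degree Polynomials.lead_coeff
  up_ring.coeff up_ring.monom Digraph_Component.connected

section \<open>Dirichlet series\<close>

text \<open>The series sum a(n) n^-s, with n^-s spelled as an exponential: every term is then entire
  in \<open>s\<close>, and its modulus depends on \<open>s\<close> through \<open>Re s\<close>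
  only.\<close>

definition dser :: "(nat \<Rightarrow> real) \<Rightarrow> complex \<Rightarrow> complex" where
  "dser a s = (\<Sum>n. of_real (a n) * exp (- s * of_real (ln (real n))))"

text \<open>The condition at \<open>0\<close> removes the junk term of \<open>dser\<close>, where \<open>ln 0 = 0\<close>.\<close>

definition log_bounded :: "(nat \<Rightarrow> real) \<Rightarrow> bool" where
  "log_bounded a \<longleftrightarrow> a 0 = 0 \<and> (\<forall>n>0. \<bar>a n\<bar> \<le> 1 + ln (real n))"

lemma summable_one_plus_ln_times_powr:
  fixes c :: real
  assumes "c > 1"
  shows "summable (\<lambda>n. (1 + ln (real n)) * real n powr (- c))"
proof -
  \<comment> \<open>Half of the excess \<open>c - 1\<close> pays for the logarithm, through ln n
    \<le> n^d / d.\<close>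
  define d where "d = (c - 1) / 2"
  have d: "d > 0" "- c + d < -1" using assms by (auto simp: d_def field_simps)
  have "summable (\<lambda>n. real n powr (- c) + (1 / d) * real n powr (- c + d))"
    using assms d by (intro summable_add summable_mult) (auto simp: summable_real_powr_iff)
  then show ?thesis
  proof (rule summable_comparison_test_ev[rotated])
    show "\<forall>\<^sub>F n in sequentially. norm ((1 + ln (real n)) * real n powr - c)
        \<le> real n powr - c + 1 / d * real n powr (- c + d)"
      using eventually_ge_at_top[of 1]
    proof eventually_elim
      case (elim n)
      then have "ln (real n) \<le> real n powr d / d" "0 \<le> ln (real n)"
        using ln_powr_bound[of "real n" d] d by auto
      then have "ln (real n) * real n powr -c \<le> real n powr d / d * real n powr -c"
        by (intro mult_right_mono) auto
      moreover have "real n powr (- c + d) = real n powr d * real n powr -c"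
        by (simp only: powr_add mult.commute)
      ultimately show ?case using \<open>0 \<le> ln (real n)\<close>
        by (simp add: abs_mult ring_distribs)
    qed
  qed
qed

lemma norm_dser_term:
  assumes "log_bounded a"
  shows "norm (of_real (a n) * exp (- s * of_real (ln (real n)))) = \<bar>a n\<bar> * real n powr (- Re s)"
  using assms by (cases "n = 0") (auto simp: norm_mult powr_def log_bounded_def)

lemma norm_dser_term_le:
  assumes "log_bounded a" "c \<le> Re s"
  shows "norm (of_real (a n) * exp (- s * of_real (ln (real n)))) \<le> (1 + ln (real n)) * real n powr (- c)"
proof (cases "n = 0")
  case False
  then have "\<bar>a n\<bar> * real n powr (- Re s) \<le> (1 + ln (real n)) * real n powr (- c)"
    using assms by (intro mult_mono powr_mono) (auto simp: log_bounded_def)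
  then show ?thesis using norm_dser_term[OF assms(1)] by simp
qed (use assms in \<open>auto simp: log_bounded_def\<close>)

lemma summable_norm_dser:
  assumes "log_bounded a" "Re s > 1"
  shows "summable (\<lambda>n. norm (of_real (a n) * exp (- s * of_real (ln (real n)))))"
  by (rule summable_comparison_test'[OF summable_one_plus_ln_times_powr[OF assms(2)]])
     (simp only: norm_of_real abs_norm_cancel norm_ge_zero abs_of_nonneg real_norm_def norm_dser_term_le[OF assms(1) order.refl])

lemma sums_dser:
  assumes "log_bounded a" "Re s > 1"
  shows "(\<lambda>n. of_real (a n) * exp (- s * of_real (ln (real n)))) sums dser a s"
  unfolding dser_def by (rule summable_sums[OF summable_norm_cancel[OF summable_norm_dser[OF assms]]])

lemma dser_has_derivative_aux:
  assumes "log_bounded a"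
  shows "\<exists>g g'. \<forall>s \<in> {s. Re s > 1}. ((\<lambda>n. of_real (a n) * exp (- s * of_real (ln (real n)))) sums g s)
     \<and> ((\<lambda>n. - of_real (a n * ln (real n)) * exp (- s * of_real (ln (real n)))) sums g' s)
     \<and> (g has_field_derivative g' s) (at s)"
proof (rule series_and_derivative_comparison_local)
  show "open {s. Re s > 1}" by (rule open_halfspace_Re_gt)
  show "((\<lambda>s. of_real (a n) * exp (- s * of_real (ln (real n)))) has_field_derivative
     - of_real (a n * ln (real n)) * exp (- s * of_real (ln (real n)))) (at s)" for n s
    by (auto intro!: derivative_eq_intros)
  fix s assume "s \<in> {s. Re s > 1}"
  \<comment> \<open>\<open>c\<close> is the midpoint of 1 and \<open>Re s\<close>. Real parts stay
    above it on the ball of radius \<open>(Re s - 1) / 2\<close>, so one summable majorant serves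
    the whole ball.\<close>
  define c where "c = (1 + Re s) / 2"
  have c: "c > 1" using \<open>s \<in> _\<close> by (auto simp: c_def)
  have "norm (of_real (a n) * exp (- y * of_real (ln (real n)))) \<le> (1 + ln (real n)) * real n powr (- c)"
    if "y \<in> ball s ((Re s - 1) / 2)" for n y
  proof (rule norm_dser_term_le[OF assms])
    have "Re s - Re y \<le> norm (s - y)" using complex_Re_le_cmod[of "s - y"] by simp
    also have "\<dots> < (Re s - 1) / 2" using that by (simp add: dist_norm)
    finally show "c \<le> Re y" by (simp add: c_def field_simps)
  qed
  then have "\<forall>\<^sub>F n in sequentially. \<forall>y\<in>ball s ((Re s - 1) / 2) \<inter> {s. Re s > 1}.
      norm (of_real (a n) * exp (- y * of_real (ln (real n)))) \<le> (1 + ln (real n)) * real n powr (- c)"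
    by (intro always_eventually allI ballI) simp
  moreover have "0 < (Re s - 1) / 2" using \<open>s \<in> _\<close> by simp
  ultimately show "\<exists>d h. 0 < d \<and> summable h \<and> (\<forall>\<^sub>F n in sequentially. \<forall>y\<in>ball s d \<inter> {s. Re s > 1}.
      norm (of_real (a n) * exp (- y * of_real (ln (real n)))) \<le> h n)"
    using summable_one_plus_ln_times_powr[OF c] by blast
qed

lemma dser_has_derivative:
  assumes "log_bounded a" "Re s > 1"
  shows "(dser a has_field_derivative - dser (\<lambda>n. a n * ln (real n)) s) (at s)"
proof -
  obtain g g' where g: "\<And>s. Re s > 1 \<Longrightarrow> (\<lambda>n. of_real (a n) * exp (- s * of_real (ln (real n)))) sums g s"
    "\<And>s. Re s > 1 \<Longrightarrow> (\<lambda>n. - of_real (a n * ln (real n)) * exp (- s * of_real (ln (real n)))) sums g' s"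
    "\<And>s. Re s > 1 \<Longrightarrow> (g has_field_derivative g' s) (at s)"
    using dser_has_derivative_aux[OF assms(1)] by blast
  have "- g' s = dser (\<lambda>n. a n * ln (real n)) s"
    using sums_unique[OF sums_minus[OF g(2)[OF assms(2)]]] unfolding dser_def by simp
  then have "g' s = - dser (\<lambda>n. a n * ln (real n)) s" by (metis minus_minus)
  moreover have "(dser a has_field_derivative g' s) (at s)"
  proof (rule has_field_derivative_transform_within_open[OF g(3)[OF assms(2)] open_halfspace_Re_gt])
    show "s \<in> {s. Re s > 1}" using assms by simp
    show "g z = dser a z" if "z \<in> {s. Re s > 1}" for z
      using that sums_unique[OF g(1)[of z]] unfolding dser_def by simp
  qed
  ultimately show ?thesis by simp
qed

section \<open>Series of the zeta function and of the von Mangoldt function\<close>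

definition one_coeff :: "nat \<Rightarrow> real" where "one_coeff n = (if n = 0 then 0 else 1)"

abbreviation zeta_ser :: "complex \<Rightarrow> complex" where "zeta_ser \<equiv> dser one_coeff"
abbreviation mangoldt_ser :: "complex \<Rightarrow> complex" where "mangoldt_ser \<equiv> dser mangoldt"

lemma log_bounded_one: "log_bounded one_coeff"
  by (auto simp: log_bounded_def one_coeff_def)

lemma log_bounded_ln: "log_bounded (\<lambda>n. ln (real n))"
  by (auto simp: log_bounded_def)

lemma mangoldt_le_ln: "n > 0 \<Longrightarrow> mangoldt n \<le> ln (real n)"
proof -
  assume n: "n > 0"
  have "mangoldt n \<le> (\<Sum>d | d dvd n. mangoldt d :: real)"
    using n by (intro member_le_sum) (auto simp: mangoldt_nonneg)
  then show ?thesis using mangoldt_sum[of n, where 'a=real] n by simp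
qed

lemma log_bounded_mangoldt: "log_bounded mangoldt"
  unfolding log_bounded_def
proof (intro conjI allI impI)
  fix n :: nat assume "n > 0"
  then show "\<bar>mangoldt n :: real\<bar> \<le> 1 + ln (real n)"
    using mangoldt_le_ln[of n] mangoldt_nonneg[of n] by linarith
qed simp

text \<open>This lifts the divisor identity for Lambda, whose sum over the divisors of n is ln n, to
  series: the double family converges absolutely, so the pairs (m, d) may be regrouped by their
  product.\<close>

lemma zeta_times_mangoldt_ser:
  assumes "Re s > 1"
  shows "zeta_ser s * mangoldt_ser s = dser (\<lambda>n. ln (real n)) s"
proof -
  define e where "e n = exp (- s * of_real (ln (real n)))" for n :: nat
  have e_mult: "e (m * d) = e m * e d" if "m > 0" "d > 0" for m d
    using that by (simp add: e_def ln_mult exp_add[symmetric] ring_distribs)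
  have hs: "((\<lambda>n. of_real (a n) * e n) has_sum dser a s) UNIV" if "log_bounded a" for a
    using norm_summable_imp_has_sum[OF summable_norm_dser[OF that assms] sums_dser[OF that assms]]
    unfolding e_def .
  \<comment> \<open>The index 0 is dropped: \<open>e\<close> is multiplicative on positive arguments
    only, and 0 has infinitely many divisors.\<close>
  have hs': "((\<lambda>n. of_real (a n) * e n) has_sum dser a s) {0<..}" if "log_bounded a" for a
    using hs[OF that] by (subst has_sum_cong_neutral[where T=UNIV and g="\<lambda>n. of_real (a n) * e n"])
      (use that in \<open>auto simp: log_bounded_def\<close>)
  define F where "F = (\<lambda>(m::nat,d). (of_real (one_coeff m) * e m) * (of_real (mangoldt d) * e d))"
  have abs: "(\<lambda>n. norm (of_real (a n) * e n)) summable_on {0<..}" if "log_bounded a" for a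
  proof -
    have "summable (\<lambda>n. norm (norm (of_real (a n) * e n)))"
      using summable_norm_dser[OF that assms] unfolding e_def by simp
    from norm_summable_imp_summable_on[OF this] show ?thesis
      by (rule summable_on_subset_banach) auto
  qed
  have "(\<lambda>x. norm (F x)) summable_on ({0<..} \<times> {0<..})"
  proof (rule summable_on_SigmaI)
    show "((\<lambda>y. norm (F (x, y))) has_sum norm (of_real (one_coeff x) * e x) *
        (\<Sum>\<^sub>\<infinity>d\<in>{0<..}. norm (of_real (mangoldt d) * e d))) {0<..}" for x
      unfolding F_def prod.case norm_mult[of "of_real (one_coeff x) * e x"]
      by (intro has_sum_cmult_right has_sum_infsum abs log_bounded_mangoldt)
    show "(\<lambda>x. norm (of_real (one_coeff x) * e x) *
        (\<Sum>\<^sub>\<infinity>d\<in>{0<..}. norm (of_real (mangoldt d) * e d))) summable_on {0<..}"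
      by (intro summable_on_cmult_left abs log_bounded_one)
  qed auto
  then have "F summable_on ({0<..} \<times> {0<..})" by (rule abs_summable_summable)
  then obtain S where S: "(F has_sum S) ({0<..} \<times> {0<..})" unfolding summable_on_def by blast
  have "((\<lambda>m. (of_real (one_coeff m) * e m) * mangoldt_ser s) has_sum S) {0<..}"
    by (rule has_sum_SigmaD[OF S])
       (use has_sum_cmult_right[OF hs'[OF log_bounded_mangoldt]] in \<open>auto simp: F_def\<close>)
  moreover have "((\<lambda>m. (of_real (one_coeff m) * e m) * mangoldt_ser s) has_sum zeta_ser s * mangoldt_ser s) {0<..}"
    by (intro has_sum_cmult_left hs' log_bounded_one)
  ultimately have S_eq: "S = zeta_ser s * mangoldt_ser s" by (rule has_sum_unique)
  have "((\<lambda>(n,d). of_real (mangoldt d) * e n) has_sum S) (SIGMA n:{0<..}. {d. d dvd n})"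
  proof (rule iffD1[OF has_sum_reindex_bij_witness[where i="\<lambda>(n,d). (n div d, d)" and j="\<lambda>(m,d). (m * d, d)"] S], goal_cases)
    case (5 a) then show ?case
      by (auto simp: F_def e_mult one_coeff_def)
  qed (auto simp: div_greater_zero_iff dvd_imp_le)
  then have "((\<lambda>n. \<Sum>d | d dvd n. of_real (mangoldt d) * e n) has_sum S) {0<..}"
    by (rule has_sum_SigmaD) (auto intro!: has_sum_finiteI)
  also have "?this \<longleftrightarrow> ((\<lambda>n. of_real (ln (real n)) * e n) has_sum S) {0<..}"
  proof (intro has_sum_cong)
    fix n :: nat assume n: "n \<in> {0<..}"
    have "(\<Sum>d | d dvd n. of_real (mangoldt d) * e n) = (\<Sum>d | d dvd n. mangoldt d) * e n"
      by (simp add: sum_distrib_right)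
    also have "(\<Sum>d | d dvd n. mangoldt d) = (of_real (ln (real n)) :: complex)"
      using n by (intro mangoldt_sum) auto
    finally show "(\<Sum>d | d dvd n. of_real (mangoldt d) * e n) = of_real (ln (real n)) * e n" .
  qed
  finally show ?thesis using has_sum_unique[OF hs'[OF log_bounded_ln]] S_eq by simp
qed

section \<open>The zeta function on the line Re s = 1\<close>

definition zeta_term :: "nat \<Rightarrow> complex \<Rightarrow> complex" where
  "zeta_term n s = (s - 1) * exp (- s * of_real (ln (real n)))
     - exp ((1 - s) * of_real (ln (real n))) + exp ((1 - s) * of_real (ln (real (Suc n))))"

text \<open>\<open>(s - 1) \<zeta>(s)\<close> for \<open>Re s > 0\<close>: multiplying \<open>\<zeta>(s) - 1 / (s - 1) = \<Sum>n. (n powr -s - \<integral> x powr -s)\<close>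
  by \<open>s - 1\<close> makes every term entire.\<close>

definition zeta_reg :: "complex \<Rightarrow> complex" where
  "zeta_reg s = 1 + (\<Sum>n. zeta_term (Suc n) s)"

text \<open>The term is the first-order Taylor remainder of \<open>x \<mapsto> x powr (1 - s)\<close> between \<open>n\<close> and \<open>n + 1\<close>.\<close>

lemma norm_zeta_term_le:
  assumes "n > 0" "Re s > 0"
  shows "norm (zeta_term n s) \<le> norm (s - 1) * norm s * real n powr (- Re s - 1)"
proof -
  define P where "P a z = exp (a * Ln z)" for a z :: complex
  have P_deriv: "(P a has_field_derivative a * P (a - 1) z) (at z within A)" if "Re z > 0" for a z A
  proof -
    have "z \<notin> \<real>\<^sub>\<le>\<^sub>0" "z \<noteq> 0" using that by (auto simp: complex_nonpos_Reals_iff)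
    then show ?thesis unfolding P_def
      by (auto intro!: derivative_eq_intros simp: ring_distribs exp_diff exp_minus field_simps)
  qed
  \<comment> \<open>\<open>f 0\<close>, \<open>f 1\<close>, \<open>f 2\<close> are x^(1 - s) and its
    first two derivatives. The linear Taylor polynomial at \<open>n\<close> supplies the first two
    summands of \<open>zeta_term\<close>, and the second derivative gives the bound.\<close>
  define f where "f i = (if i = 0 then P (1 - s) else if i = 1 then (\<lambda>z. (1 - s) * P (- s) z)
      else (\<lambda>z. (1 - s) * (- s * P (- s - 1) z)))" for i :: nat
  define S where "S = closed_segment (complex_of_real (real n)) (complex_of_real (real (Suc n)))"
  have S: "\<exists>x. z = of_real x \<and> real n \<le> x" if "z \<in> S" for z
    using that unfolding S_def closed_segment_of_real by (auto simp: closed_segment_eq_real_ivl split: if_splits)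
  have "norm (f 0 (of_real (real (Suc n))) - (\<Sum>i\<le>1. f i (of_real (real n)) * (of_real (real (Suc n)) - of_real (real n)) ^ i / fact i))
      \<le> norm (s - 1) * norm s * real n powr (- Re s - 1) * norm (of_real (real (Suc n)) - of_real (real n) :: complex) ^ Suc 1 / fact 1"
  proof (rule complex_Taylor)
    show "convex S" unfolding S_def by simp
    show "of_real (real n) \<in> S" "of_real (real (Suc n)) \<in> S" unfolding S_def by simp_all
    show "(f i has_field_derivative f (Suc i) x) (at x within S)" if "x \<in> S" "i \<le> 1" for i x
    proof -
      have "Re x > 0" using S[OF that(1)] assms by auto
      from P_deriv[OF this] have "(P (1 - s) has_field_derivative (1 - s) * P (- s) x) (at x within S)"
        "((\<lambda>z. (1 - s) * P (- s) z) has_field_derivative (1 - s) * (- s * P (- s - 1) x)) (at x within S)"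
        using P_deriv[OF \<open>Re x > 0\<close>, of "1 - s" S]
          DERIV_cmult[OF P_deriv[OF \<open>Re x > 0\<close>, of "- s" S], of "1 - s"] by simp_all
      then show ?thesis using that(2) by (cases "i = 0") (auto simp: f_def)
    qed
    show "cmod (f (Suc 1) x) \<le> norm (s - 1) * norm s * real n powr (- Re s - 1)" if "x \<in> S" for x
    proof -
      obtain y where y: "x = of_real y" "real n \<le> y" using S[OF \<open>x \<in> S\<close>] by blast
      have "norm (P (- s - 1) x) = y powr (- Re s - 1)"
        using y assms by (simp add: P_def powr_def Ln_of_real)
      also have "\<dots> \<le> real n powr (- Re s - 1)" using y assms by (intro powr_mono2') auto
      finally have "norm (P (- s - 1) x) \<le> real n powr (- Re s - 1)" .
      then show ?thesis unfolding f_def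
        by (auto simp: norm_mult norm_minus_commute mult.assoc intro!: mult_left_mono)
    qed
  qed
  also have "f 0 (of_real (real (Suc n))) - (\<Sum>i\<le>1. f i (of_real (real n)) * (of_real (real (Suc n)) - of_real (real n)) ^ i / fact i)
      = zeta_term n s"
  proof -
    have 2: "Ln (complex_of_real (real n)) = of_real (ln (real n))"
      "Ln (complex_of_real (real (Suc n))) = of_real (ln (real (Suc n)))"
      using assms by (simp_all only: Ln_of_real of_nat_0_less_iff zero_less_Suc)
    have 3: "(\<Sum>i\<le>1. h i) = h 0 + h 1" for h :: "nat \<Rightarrow> complex" by simp
    show ?thesis
      unfolding 3 f_def P_def zeta_term_def using 2[simplified] by (simp add: algebra_simps)
  qed
  finally show ?thesis by simp
qed

text \<open>The terms decay like n^(-Re s - 1), one power better than those of zeta itself, so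
  convergence is locally uniform as far as Re s > 0.\<close>

lemma zeta_reg_aux:
  "\<exists>g g'. \<forall>s \<in> {s. Re s > 0}. ((\<lambda>n. zeta_term (Suc n) s) sums g s)
     \<and> ((\<lambda>n. deriv (zeta_term (Suc n)) s) sums g' s) \<and> (g has_field_derivative g' s) (at s)"
proof (rule series_and_derivative_comparison_local)
  show "open {s. Re s > 0}" by (rule open_halfspace_Re_gt)
  show "(zeta_term (Suc n) has_field_derivative deriv (zeta_term (Suc n)) s) (at s)" for n s
  proof -
    have "zeta_term (Suc n) field_differentiable (at s)"
      unfolding zeta_term_def field_differentiable_def by (rule exI) (rule derivative_eq_intros refl)+
    then show ?thesis by (simp add: field_differentiable_derivI)
  qed
  fix s assume "s \<in> {s. Re s > 0}"
  then have s: "Re s > 0" by simp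
  \<comment> \<open>On the ball of radius \<open>Re s / 2\<close> around \<open>s\<close>,
    \<open>M\<close> bounds |y - 1| |y|, and \<open>Re y > Re s / 2\<close> keeps the exponent below
    -1.\<close>
  define M where "M = (norm s + Re s + 1)\<^sup>2"
  define h where "h n = M * real (Suc n) powr (- Re s / 2 - 1)" for n
  have "summable (\<lambda>n. real n powr (- Re s / 2 - 1))" using s by (simp add: summable_real_powr_iff)
  then have h: "summable h" unfolding h_def
    by (intro summable_mult) (subst summable_Suc_iff)
  have "norm (zeta_term (Suc n) y) \<le> h n" if "y \<in> ball s (Re s / 2) \<inter> {s. Re s > 0}" for n y
  proof -
    have d: "norm (s - y) < Re s / 2" using that by (simp add: dist_norm)
    have "Re s - Re y \<le> norm (s - y)" using complex_Re_le_cmod[of "s - y"] by simp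
    then have y: "Re y > Re s / 2" using d by (simp add: field_simps)
    have "norm y \<le> norm s + Re s"
      using norm_triangle_ineq4[of s "s - y"] d s by simp
    moreover have "norm (y - 1) \<le> norm y + 1" using norm_triangle_ineq4[of y 1] by simp
    ultimately have "norm (y - 1) * norm y \<le> M" unfolding M_def power2_eq_square
      using s by (intro mult_mono) auto
    moreover have "real (Suc n) powr (- Re y - 1) \<le> real (Suc n) powr (- Re s / 2 - 1)"
      using y by (intro powr_mono) auto
    ultimately have "norm (y - 1) * norm y * real (Suc n) powr (- Re y - 1) \<le> h n"
      unfolding h_def by (intro mult_mono) (auto simp: M_def)
    then show ?thesis using norm_zeta_term_le[of "Suc n" y] that by auto
  qed
  then show "\<exists>d h. 0 < d \<and> summable h \<and> (\<forall>\<^sub>F n in sequentially. \<forall>y\<in>ball s d \<inter> {s. Re s > 0}.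
      norm (zeta_term (Suc n) y) \<le> h n)"
    using h s by (intro exI[of _ "Re s / 2"] exI[of _ h] conjI always_eventually allI ballI) simp_all
qed

lemma zeta_term_sums:
  assumes "Re s > 0"
  shows "(\<lambda>n. zeta_term (Suc n) s) sums (zeta_reg s - 1)"
proof -
  obtain g g' where "\<forall>s \<in> {s. Re s > 0}. ((\<lambda>n. zeta_term (Suc n) s) sums g s)
     \<and> ((\<lambda>n. deriv (zeta_term (Suc n)) s) sums g' s) \<and> (g has_field_derivative g' s) (at s)"
    using zeta_reg_aux by blast
  then have "(\<lambda>n. zeta_term (Suc n) s) sums g s" using assms by simp
  then show ?thesis unfolding zeta_reg_def by (simp add: sums_iff)
qed

lemma holomorphic_zeta_reg: "zeta_reg holomorphic_on {s. Re s > 0}"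
proof -
  obtain g g' where g: "\<forall>s \<in> {s. Re s > 0}. ((\<lambda>n. zeta_term (Suc n) s) sums g s)
     \<and> ((\<lambda>n. deriv (zeta_term (Suc n)) s) sums g' s) \<and> (g has_field_derivative g' s) (at s)"
    using zeta_reg_aux by blast
  then have "(\<lambda>s. 1 + g s) holomorphic_on {s. Re s > 0}"
    by (intro holomorphic_intros) (auto simp: holomorphic_on_open open_halfspace_Re_gt)
  then show ?thesis
    by (rule holomorphic_transform) (use g in \<open>auto simp: zeta_reg_def sums_iff\<close>)
qed

lemma zeta_reg_1: "zeta_reg 1 = 1"
  by (simp add: zeta_reg_def zeta_term_def)

text \<open>The differences of n^(1 - s) telescope. For Re s > 1 these powers tend to 0, so the
  differences sum to -1 and cancel the leading 1 of \<open>zeta_reg\<close>.\<close>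

lemma zeta_reg_eq:
  assumes "Re s > 1"
  shows "zeta_reg s = (s - 1) * zeta_ser s"
proof -
  define g where "g n = exp ((1 - s) * of_real (ln (real (Suc n))))" for n
  have "(\<lambda>n. norm (g n)) = (\<lambda>n. real (Suc n) powr (1 - Re s))"
    by (simp add: g_def powr_def fun_eq_iff)
  moreover have "\<dots> \<longlonglongrightarrow> 0"
  proof (rule tendsto_neg_powr)
    show "filterlim (\<lambda>n. real (Suc n)) at_top sequentially" by real_asymp
  qed (use assms in auto)
  ultimately have "(\<lambda>n. norm (g n)) \<longlonglongrightarrow> 0" by simp
  then have "g \<longlonglongrightarrow> 0" by (rule tendsto_norm_zero_cancel)
  then have tel: "(\<lambda>n. g (Suc n) - g n) sums (0 - g 0)" by (rule telescope_sums)
  have "(\<lambda>n. of_real (one_coeff (Suc n)) * exp (- s * of_real (ln (real (Suc n))))) sums zeta_ser s"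
    using sums_dser[OF log_bounded_one assms] by (subst sums_Suc_iff) (simp add: one_coeff_def)
  then have "(\<lambda>n. (s - 1) * exp (- s * of_real (ln (real (Suc n))))) sums ((s - 1) * zeta_ser s)"
    by (intro sums_mult) (simp add: one_coeff_def)
  from sums_add[OF this tel]
  have "(\<lambda>n. (s - 1) * exp (- s * of_real (ln (real (Suc n)))) + (g (Suc n) - g n)) sums ((s - 1) * zeta_ser s - 1)"
    by (simp add: g_def)
  also have "(\<lambda>n. (s - 1) * exp (- s * of_real (ln (real (Suc n)))) + (g (Suc n) - g n)) = (\<lambda>n. zeta_term (Suc n) s)"
    by (simp add: zeta_term_def g_def fun_eq_iff)
  finally have "(\<lambda>n. zeta_term (Suc n) s) sums ((s - 1) * zeta_ser s - 1)" .
  from sums_unique2[OF this zeta_term_sums] show ?thesis using assms by simp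
qed

text \<open>The logarithmic derivative of (s - 1) zeta(s), multiplied out so that no zero has to be
  excluded beforehand.\<close>

lemma mangoldt_ser_times_zeta_reg:
  assumes "Re s > 1"
  shows "mangoldt_ser s * zeta_reg s = zeta_reg s / (s - 1) - deriv zeta_reg s"
proof -
  have "((\<lambda>s. (s - 1) * zeta_ser s) has_field_derivative
      zeta_ser s + (s - 1) * (- dser (\<lambda>n. one_coeff n * ln (real n)) s)) (at s)"
    using dser_has_derivative[OF log_bounded_one assms] by (auto intro!: derivative_eq_intros)
  moreover have "(\<lambda>n. one_coeff n * ln (real n)) = (\<lambda>n. ln (real n))" by (auto simp: one_coeff_def)
  ultimately have "((\<lambda>s. (s - 1) * zeta_ser s) has_field_derivative
      zeta_ser s - (s - 1) * (zeta_ser s * mangoldt_ser s)) (at s)"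
    using zeta_times_mangoldt_ser[OF assms] by simp
  then have "(zeta_reg has_field_derivative zeta_ser s - (s - 1) * (zeta_ser s * mangoldt_ser s)) (at s)"
    by (rule has_field_derivative_transform_within_open[OF _ open_halfspace_Re_gt[of 1]])
       (use assms in \<open>auto simp: zeta_reg_eq\<close>)
  then have "deriv zeta_reg s = zeta_ser s - (s - 1) * (zeta_ser s * mangoldt_ser s)"
    by (rule DERIV_imp_deriv)
  moreover have "s \<noteq> 1" using assms by auto
  ultimately show ?thesis using zeta_reg_eq[OF assms] by simp
qed

section \<open>Absence of zeros for Re s \<ge> 1\<close>

text \<open>\<open>k\<close> is the order of vanishing at \<open>s0\<close>: factoring f = (s -
  s0)^k g with \<open>g\<close> zero-free near \<open>s0\<close> gives f'/f = k / (s - s0) +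
  g'/g.\<close>

lemma tendsto_order_log_deriv:
  assumes "f holomorphic_on S" "open S" "connected S" "s0 \<in> S" "\<not> f constant_on S"
  obtains k :: nat where "((\<lambda>s. (s - s0) * deriv f s / f s) \<longlongrightarrow> of_nat k) (at s0)"
    "\<forall>\<^sub>F s in at s0. f s \<noteq> 0" "f s0 = 0 \<longleftrightarrow> k > 0"
proof (cases "f s0 = 0")
  case True
  obtain g r n where g: "0 < n" "0 < r" "ball s0 r \<subseteq> S" "g holomorphic_on ball s0 r"
     "\<And>w. w \<in> ball s0 r \<Longrightarrow> f w = (w - s0)^n * g w" "\<And>w. w \<in> ball s0 r \<Longrightarrow> g w \<noteq> 0"
    by (rule holomorphic_factor_zero_nonconstant[OF assms(1-4) True assms(5)]) (rule that)
  have ev: "\<forall>\<^sub>F s in at s0. s \<in> ball s0 r \<and> s \<noteq> s0"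
    using g(2) by (auto simp: eventually_at dist_commute intro!: exI[of _ r])
  have eq: "of_nat n + (s - s0) * (deriv g s / g s) = (s - s0) * deriv f s / f s"
    if s: "s \<in> ball s0 r" "s \<noteq> s0" for s
  proof -
    have "(g has_field_derivative deriv g s) (at s)"
      by (rule holomorphic_derivI[OF g(4) open_ball s(1)])
    then have "((\<lambda>w. (w - s0)^n * g w) has_field_derivative
        of_nat n * (s - s0)^(n - 1) * g s + (s - s0)^n * deriv g s) (at s)"
      by (auto intro!: derivative_eq_intros simp: mult_ac)
    then have "(f has_field_derivative of_nat n * (s - s0)^(n - 1) * g s + (s - s0)^n * deriv g s) (at s)"
      by (rule has_field_derivative_transform_within_open[OF _ open_ball s(1)]) (use g(5) in auto)
    then have "deriv f s = of_nat n * (s - s0)^(n - 1) * g s + (s - s0)^n * deriv g s"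
      by (rule DERIV_imp_deriv)
    moreover have "(s - s0)^n = (s - s0) * (s - s0)^(n - 1)" using g(1) power_eq_if[of "s - s0" n] by simp
    ultimately have 1: "deriv f s = of_nat n * (s - s0)^(n - 1) * g s + (s - s0) * (s - s0)^(n - 1) * deriv g s"
      "f s = (s - s0) * (s - s0)^(n - 1) * g s" using g(5)[OF s(1)] by simp_all
    \<comment> \<open>Here x stands for s - s0 and y for (s - s0)^(n - 1), so the common factor x y
      = (s - s0)^n cancels.\<close>
    have 2: "c + x * (G' / G) = x * (c * y * G + x * y * G') / (x * y * G)"
      if "x \<noteq> 0" "y \<noteq> 0" "G \<noteq> 0" for c x y G G' :: complex
    proof -
      have "x * (c * y * G + x * y * G') = (x * y) * (c * G + x * G')" by (simp add: algebra_simps)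
      then show ?thesis using that by (simp add: add_divide_distrib)
    qed
    have nz: "s - s0 \<noteq> 0" "(s - s0) ^ (n - 1) \<noteq> 0" using s by auto
    show ?thesis unfolding 1 by (rule 2[OF nz g(6)[OF s(1)]])
  qed
  have "continuous_on (ball s0 r) (\<lambda>s. of_nat n + (s - s0) * (deriv g s / g s))"
    using g by (intro continuous_intros holomorphic_on_imp_continuous_on holomorphic_deriv) auto
  then have "isCont (\<lambda>s. of_nat n + (s - s0) * (deriv g s / g s)) s0"
    using g(2) by (simp add: continuous_on_eq_continuous_at)
  then have "((\<lambda>s. of_nat n + (s - s0) * (deriv g s / g s)) \<longlongrightarrow> of_nat n) (at s0)"
    by (simp add: isCont_def)
  then have "((\<lambda>s. (s - s0) * deriv f s / f s) \<longlongrightarrow> of_nat n) (at s0)"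
    by (rule Lim_transform_eventually) (rule eventually_mono[OF ev], rule eq, simp_all)
  moreover have "\<forall>\<^sub>F s in at s0. f s \<noteq> 0" using ev by eventually_elim (use g in auto)
  ultimately show ?thesis using that[of n] True g(1) by simp
next
  case False
  have c: "isCont f s0"
    using holomorphic_on_imp_continuous_on[OF assms(1)] assms(2,4) by (simp add: continuous_on_eq_continuous_at)
  have c': "isCont (deriv f) s0"
    using holomorphic_on_imp_continuous_on[OF holomorphic_deriv[OF assms(1,2)]] assms(2,4)
    by (simp add: continuous_on_eq_continuous_at)
  have "isCont (\<lambda>s. (s - s0) * deriv f s / f s) s0"
    using c c' False by (intro continuous_intros) auto
  then have "((\<lambda>s. (s - s0) * deriv f s / f s) \<longlongrightarrow> of_nat 0) (at s0)"
    by (simp add: isCont_def)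
  moreover have "\<forall>\<^sub>F s in at s0. f s \<noteq> 0"
    using c False by (auto simp: isCont_def intro: tendsto_imp_eventually_ne)
  ultimately show ?thesis using that[of 0] False by simp
qed

text \<open>A constant value would be \<open>zeta_reg 1 = 1\<close>, hence 2 zeta(3) = 1, although
  the term n = 1 alone contributes 1 to zeta(3). This ensures that zeros have finite order.\<close>

lemma zeta_reg_not_constant: "\<not> zeta_reg constant_on {s. Re s > 0}"
proof
  assume "zeta_reg constant_on {s. Re s > 0}"
  then have "zeta_reg 3 = zeta_reg 1" by (auto simp: constant_on_def)
  then have "zeta_ser 3 = 1 / 2" using zeta_reg_eq[of 3] zeta_reg_1 by (simp add: field_simps)
  from arg_cong[OF this, of Re] have "Re (zeta_ser 3) = 1 / 2" by simp
  moreover have "(\<lambda>n. one_coeff n * real n powr (-3)) sums Re (zeta_ser 3)"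
  proof -
    have "Re (of_real (one_coeff n) * exp (- 3 * of_real (ln (real n)))) = one_coeff n * real n powr (-3)" for n
      by (cases "n = 0") (auto simp: one_coeff_def powr_def exp_of_real Re_exp)
    then show ?thesis using sums_Re[OF sums_dser[OF log_bounded_one, of 3]] by (simp only:) simp
  qed
  then have "(\<Sum>n\<in>{1}. one_coeff n * real n powr (-3)) \<le> Re (zeta_ser 3)"
    unfolding sums_iff using sum_le_suminf[of "\<lambda>n. one_coeff n * real n powr (-3)" "{1}"]
    by (auto simp: one_coeff_def)
  ultimately show False by (simp add: one_coeff_def)
qed

lemma zeta_reg_order:
  assumes "Re s0 > 0"
  obtains k :: nat where "((\<lambda>s. (s - s0) * deriv zeta_reg s / zeta_reg s) \<longlongrightarrow> of_nat k) (at s0)"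
    "\<forall>\<^sub>F s in at s0. zeta_reg s \<noteq> 0" "zeta_reg s0 = 0 \<longleftrightarrow> k > 0"
  using tendsto_order_log_deriv[OF holomorphic_zeta_reg open_halfspace_Re_gt, of s0]
    assms zeta_reg_not_constant convex_connected[OF convex_halfspace_Re_gt[of 0]] by auto

text \<open>At a zero of order k > 0 the logarithmic derivative would have residue k, but it equals
  1 / (s - 1) - \<open>mangoldt_ser s\<close>, which is continuous at \<open>s0\<close>.\<close>

lemma zeta_reg_nonzero_gt_1:
  assumes "Re s0 > 1"
  shows "zeta_reg s0 \<noteq> 0"
proof
  assume 0: "zeta_reg s0 = 0"
  obtain k :: nat where k: "((\<lambda>s. (s - s0) * deriv zeta_reg s / zeta_reg s) \<longlongrightarrow> of_nat k) (at s0)"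
    "\<forall>\<^sub>F s in at s0. zeta_reg s \<noteq> 0" "k > 0"
    using zeta_reg_order[of s0] assms 0 by auto
  have "isCont mangoldt_ser s0"
    using dser_has_derivative[OF log_bounded_mangoldt assms] DERIV_isCont by blast
  then have "((\<lambda>s. (s - s0) * (1 / (s - 1) - mangoldt_ser s)) \<longlongrightarrow> (s0 - s0) * (1 / (s0 - 1) - mangoldt_ser s0)) (at s0)"
    using assms by (intro tendsto_intros) (auto simp: isCont_def)
  moreover have "\<forall>\<^sub>F s in at s0. (s - s0) * (1 / (s - 1) - mangoldt_ser s) = (s - s0) * deriv zeta_reg s / zeta_reg s"
    using k(2) eventually_at_in_open'[OF open_halfspace_Re_gt[of 1], of s0, simplified, OF assms]
  proof eventually_elim
    case (elim s)
    then have "deriv zeta_reg s = zeta_reg s * (1 / (s - 1) - mangoldt_ser s)"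
      using mangoldt_ser_times_zeta_reg[of s] by (simp add: algebra_simps)
    then show ?case using elim by simp
  qed
  ultimately have "((\<lambda>s. (s - s0) * deriv zeta_reg s / zeta_reg s) \<longlongrightarrow> (s0 - s0) * (1 / (s0 - 1) - mangoldt_ser s0)) (at s0)"
    by (rule Lim_transform_eventually)
  from tendsto_unique[OF _ this k(1)] have "of_nat k = (0::complex)" by simp
  then show False using k(3) by simp
qed

lemma mangoldt_ser_eq:
  assumes "Re s > 1"
  shows "mangoldt_ser s = 1 / (s - 1) - deriv zeta_reg s / zeta_reg s"
  using mangoldt_ser_times_zeta_reg[OF assms] zeta_reg_nonzero_gt_1[OF assms]
  by (simp add: field_simps)

text \<open>Lambda is nonnegative and 3 + 4 cos v + cos 2v = 2 (1 + cos v)^2.\<close>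

lemma Re_mangoldt_ser_3_4_1:
  assumes "c > 1"
  shows "0 \<le> Re (3 * mangoldt_ser (Complex c 0) + 4 * mangoldt_ser (Complex c u) + mangoldt_ser (Complex c (2 * u)))"
proof -
  have *: "(\<lambda>n. mangoldt n * real n powr (- c) * cos (v * ln (real n))) sums Re (mangoldt_ser (Complex c v))" for v
  proof -
    have "Re (of_real (mangoldt n) * exp (- Complex c v * of_real (ln (real n)))) = mangoldt n * real n powr (- c) * cos (v * ln (real n))" for n
      by (cases "n = 0") (auto simp: powr_def Re_exp simp del: of_real_mangoldt)
    moreover have "Re (Complex c v) > 1" using assms by simp
    ultimately show ?thesis using sums_Re[OF sums_dser[OF log_bounded_mangoldt, of "Complex c v"]] by (simp only:)
  qed
  define m where "m n v = mangoldt n * real n powr (- c) * cos (v * ln (real n))" for n v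
  have S: "(\<lambda>n. 3 * m n 0 + 4 * m n u + m n (2 * u)) sums
      (3 * Re (mangoldt_ser (Complex c 0)) + 4 * Re (mangoldt_ser (Complex c u)) + Re (mangoldt_ser (Complex c (2 * u))))"
    unfolding m_def by (rule sums_add[OF sums_add[OF sums_mult[OF *] sums_mult[OF *]] *])
  have "0 \<le> 3 * Re (mangoldt_ser (Complex c 0)) + 4 * Re (mangoldt_ser (Complex c u)) + Re (mangoldt_ser (Complex c (2 * u)))"
  proof (rule sums_le[OF _ sums_zero S])
    fix n
    have "cos (2 * u * ln (real n)) = 2 * (cos (u * ln (real n)))\<^sup>2 - 1"
      using cos_double_cos[of "u * ln (real n)"] by (simp add: mult.assoc)
    then have "m n (2 * u) = mangoldt n * real n powr (- c) * (2 * (cos (u * ln (real n)))\<^sup>2 - 1)"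
      by (simp only: m_def)
    moreover have "3 * (x * 1) + 4 * (x * y) + x * (2 * y\<^sup>2 - 1) = x * (2 * (1 + y)\<^sup>2)" for x y :: real
      by (simp add: power2_eq_square algebra_simps)
    ultimately have "3 * m n 0 + 4 * m n u + m n (2 * u) = mangoldt n * real n powr (- c) * (2 * (1 + cos (u * ln (real n)))\<^sup>2)"
      by (simp only: m_def mult_zero_left cos_zero)
    then show "0 \<le> 3 * m n 0 + 4 * m n u + m n (2 * u)" by (simp add: mangoldt_nonneg)
  qed
  then show ?thesis by simp
qed

text \<open>Approaching 1 + iu horizontally from the right, a zero of \<open>zeta_reg\<close> of
  order \<open>k\<close> contributes -k, and the pole of zeta contributes 1 when u = 0.\<close>

lemma tendsto_mangoldt_ser_residue:
  assumes "((\<lambda>s. (s - Complex 1 u) * deriv zeta_reg s / zeta_reg s) \<longlongrightarrow> of_nat k) (at (Complex 1 u))"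
  shows "((\<lambda>c. (c - 1) * Re (mangoldt_ser (Complex c u))) \<longlongrightarrow> (if u = 0 then 1 else 0) - real k) (at_right 1)"
proof -
  have lim: "filterlim (\<lambda>c. Complex c u) (at (Complex 1 u)) (at_right 1)"
  proof (rule filterlim_atI)
    show "((\<lambda>c. Complex c u) \<longlongrightarrow> Complex 1 u) (at_right 1)" by (intro tendsto_intros)
    show "\<forall>\<^sub>F c in at_right 1. Complex c u \<noteq> Complex 1 u"
      using eventually_at_right_less[of 1] by eventually_elim auto
  qed
  have "((\<lambda>c. (Complex c u - Complex 1 u) * deriv zeta_reg (Complex c u) / zeta_reg (Complex c u)) \<longlongrightarrow> of_nat k) (at_right 1)"
    using filterlim_compose[OF assms lim] .
  moreover have "((\<lambda>c. complex_of_real (c - 1) / (Complex c u - 1)) \<longlongrightarrow> (if u = 0 then 1 else 0)) (at_right 1)"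
  proof (cases "u = 0")
    case True
    have "\<forall>\<^sub>F c in at_right 1. complex_of_real (c - 1) / (Complex c u - 1) = (if u = 0 then 1 else 0)"
      using eventually_at_right_less[of 1]
    proof eventually_elim
      case (elim c)
      have "Complex c u - 1 = complex_of_real (c - 1)" using True by (simp add: complex_eq_iff)
      then show ?case using elim True by simp
    qed
    then show ?thesis by (rule tendsto_eventually)
  next
    case False
    then have "((\<lambda>c. complex_of_real (c - 1) / (Complex c u - 1)) \<longlongrightarrow> complex_of_real (1 - 1) / (Complex 1 u - 1)) (at_right 1)"
      by (intro tendsto_intros) (auto simp: complex_eq_iff)
    then show ?thesis using False by simp
  qed
  ultimately have "((\<lambda>c. complex_of_real (c - 1) / (Complex c u - 1) - (Complex c u - Complex 1 u) * deriv zeta_reg (Complex c u) / zeta_reg (Complex c u))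
    \<longlongrightarrow> (if u = 0 then 1 else 0) - of_nat k) (at_right 1)"
    by (intro tendsto_diff)
  then have "((\<lambda>c. Re (complex_of_real (c - 1) / (Complex c u - 1) - (Complex c u - Complex 1 u) * deriv zeta_reg (Complex c u) / zeta_reg (Complex c u)))
    \<longlongrightarrow> Re ((if u = 0 then 1 else 0) - of_nat k)) (at_right 1)"
    by (rule tendsto_Re)
  moreover have "Re ((if u = 0 then 1 else 0) - of_nat k) = (if u = 0 then 1 else 0) - real k" by simp
  ultimately have "((\<lambda>c. Re (complex_of_real (c - 1) / (Complex c u - 1) - (Complex c u - Complex 1 u) * deriv zeta_reg (Complex c u) / zeta_reg (Complex c u)))
    \<longlongrightarrow> (if u = 0 then 1 else 0) - real k) (at_right 1)"
    by (simp only:)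
  moreover have "\<forall>\<^sub>F c in at_right 1. Re (complex_of_real (c - 1) / (Complex c u - 1) - (Complex c u - Complex 1 u) * deriv zeta_reg (Complex c u) / zeta_reg (Complex c u))
     = (c - 1) * Re (mangoldt_ser (Complex c u))"
    using eventually_at_right_less[of 1]
  proof eventually_elim
    case (elim c)
    have "Complex c u - Complex 1 u = of_real (c - 1)" by (simp add: complex_eq_iff)
    then have "complex_of_real (c - 1) / (Complex c u - 1) - (Complex c u - Complex 1 u) * deriv zeta_reg (Complex c u) / zeta_reg (Complex c u)
       = of_real (c - 1) * mangoldt_ser (Complex c u)"
      using mangoldt_ser_eq[of "Complex c u"] elim by (simp add: right_diff_distrib)
    then show ?case by (simp only:) simp
  qed
  ultimately show ?thesis by (rule Lim_transform_eventually)
qed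

text \<open>Multiply the 3-4-1 inequality by c - 1 and let c decrease to 1. A zero at 1 + iu has u
  \<noteq> 0 because \<open>zeta_reg 1 = 1\<close>, and then the limit is at most 3 - 4, which is
  negative.\<close>

lemma zeta_reg_nonzero_line: "zeta_reg (Complex 1 u) \<noteq> 0"
proof
  assume 0: "zeta_reg (Complex 1 u) = 0"
  have "u \<noteq> 0" using 0 zeta_reg_1 by (auto simp: Complex_eq)
  obtain k0 :: nat where k0: "((\<lambda>s. (s - Complex 1 0) * deriv zeta_reg s / zeta_reg s) \<longlongrightarrow> of_nat k0) (at (Complex 1 0))"
    using zeta_reg_order[of "Complex 1 0"] by auto
  obtain k1 :: nat where k1: "((\<lambda>s. (s - Complex 1 u) * deriv zeta_reg s / zeta_reg s) \<longlongrightarrow> of_nat k1) (at (Complex 1 u))"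
    "k1 > 0" using zeta_reg_order[of "Complex 1 u"] 0 by auto
  obtain k2 :: nat where k2: "((\<lambda>s. (s - Complex 1 (2*u)) * deriv zeta_reg s / zeta_reg s) \<longlongrightarrow> of_nat k2) (at (Complex 1 (2*u)))"
    using zeta_reg_order[of "Complex 1 (2*u)"] by auto
  define F where "F c = 3 * ((c - 1) * Re (mangoldt_ser (Complex c 0))) + 4 * ((c - 1) * Re (mangoldt_ser (Complex c u)))
      + (c - 1) * Re (mangoldt_ser (Complex c (2 * u)))" for c
  have "(F \<longlongrightarrow> 3 * ((if (0::real) = 0 then 1 else 0) - real k0) + 4 * ((if u = 0 then 1 else 0) - real k1) + ((if 2 * u = 0 then 1 else 0) - real k2)) (at_right 1)"
    unfolding F_def by (intro tendsto_intros tendsto_mangoldt_ser_residue k0 k1 k2)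
  moreover have "\<forall>\<^sub>F c in at_right 1. 0 \<le> F c"
    using eventually_at_right_less[of 1]
  proof eventually_elim
    case (elim c)
    have "F c = (c - 1) * Re (3 * mangoldt_ser (Complex c 0) + 4 * mangoldt_ser (Complex c u) + mangoldt_ser (Complex c (2 * u)))"
      by (simp add: F_def algebra_simps)
    then show ?case using Re_mangoldt_ser_3_4_1[OF elim, of u] elim by simp
  qed
  ultimately have "0 \<le> 3 * ((if (0::real) = 0 then 1 else 0) - real k0) + 4 * ((if u = 0 then 1 else 0) - real k1) + ((if 2 * u = 0 then 1 else 0) - real k2)"
    by (rule tendsto_lowerbound) simp
  then show False using \<open>u \<noteq> 0\<close> k1(2) by simp
qed

text \<open>The analytic input to the Tauberian argument: removing the pole leaves -f'/f for f =
  \<open>zeta_reg\<close>, which is holomorphic around the closed half-plane because f has no zeros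
  there.\<close>

theorem mangoldt_ser_extension:
  obtains U g where "open U" "{z. Re z \<ge> 0} \<subseteq> U" "g holomorphic_on U"
    "\<And>z. Re z > 0 \<Longrightarrow> mangoldt_ser (1 + z) = 1 / z + g z"
proof
  define V where "V = {s. Re s > 0} \<inter> zeta_reg -` (- {0})"
  define U where "U = (\<lambda>z. 1 + z) -` V"
  have "open V" unfolding V_def
    by (intro continuous_open_preimage holomorphic_on_imp_continuous_on holomorphic_zeta_reg open_halfspace_Re_gt) auto
  then show "open U" unfolding U_def by (intro open_vimage continuous_intros)
  show "{z. Re z \<ge> 0} \<subseteq> U"
  proof safe
    fix z assume "Re z \<ge> 0"
    have "zeta_reg (1 + z) \<noteq> 0"
    proof (cases "Re z = 0")
      case True
      then have "1 + z = Complex 1 (Im z)" by (simp add: complex_eq_iff)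
      then show ?thesis using zeta_reg_nonzero_line by simp
    qed (use zeta_reg_nonzero_gt_1[of "1 + z"] \<open>Re z \<ge> 0\<close> in auto)
    then show "z \<in> U" using \<open>Re z \<ge> 0\<close> by (simp add: U_def V_def)
  qed
  have "(\<lambda>s. - deriv zeta_reg s / zeta_reg s) holomorphic_on V"
    by (intro holomorphic_intros holomorphic_on_subset[OF holomorphic_zeta_reg]
        holomorphic_on_subset[OF holomorphic_deriv[OF holomorphic_zeta_reg open_halfspace_Re_gt]]) (auto simp: V_def)
  then have "(\<lambda>s. - deriv zeta_reg s / zeta_reg s) \<circ> (\<lambda>z. 1 + z) holomorphic_on U"
    by (rule holomorphic_on_compose_gen[rotated]) (auto simp: U_def intro!: holomorphic_intros)
  then show "(\<lambda>z. - deriv zeta_reg (1 + z) / zeta_reg (1 + z)) holomorphic_on U" by (simp add: o_def)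
  show "mangoldt_ser (1 + z) = 1 / z + - deriv zeta_reg (1 + z) / zeta_reg (1 + z)" if "Re z > 0" for z
    using mangoldt_ser_eq[of "1 + z"] that by simp
qed

section \<open>Wiener-Ikehara with the Fejer kernel\<close>

text \<open>The Fejer kernel T (sin(Tu/2) / (Tu/2))^2 with its continuous value at 0. It is the
  Fourier transform of the triangle 1 - |x|/T on [-T, T] and has total mass 2 pi.\<close>

definition fejer :: "real \<Rightarrow> real \<Rightarrow> real" where
  "fejer T u = (if u = 0 then T else 2 * (1 - cos (T * u)) / (T * u\<^sup>2))"

lemma fejer_has_integral:
  assumes "T > 0"
  shows "((\<lambda>x. (1 - x / T) * cos (x * u)) has_integral fejer T u / 2) {0..T}"
proof (cases "u = 0")
  case True
  have "((\<lambda>x. 1 - x / T) has_integral (T - T\<^sup>2 / (2 * T)) - (0 - 0\<^sup>2 / (2 * T))) {0..T}"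
    using assms by (intro fundamental_theorem_of_calculus)
      (auto intro!: derivative_eq_intros simp flip: has_real_derivative_iff_has_vector_derivative)
  moreover have "T - T\<^sup>2 / (2 * T) = T / 2" using assms by (simp add: power2_eq_square)
  ultimately show ?thesis using True by (simp add: fejer_def)
next
  case False
  \<comment> \<open>The antiderivative obtained from one integration by parts.\<close>
  define F where "F x = (1 - x / T) * sin (x * u) / u - cos (x * u) / (T * u\<^sup>2)" for x
  have "((\<lambda>x. (1 - x / T) * cos (x * u)) has_integral F T - F 0) {0..T}"
  proof (rule fundamental_theorem_of_calculus)
    fix x
    have "(F has_real_derivative (1 - x / T) * cos (x * u)) (at x within {0..T})"
      unfolding F_def using assms False
      by (auto intro!: derivative_eq_intros simp: field_simps power2_eq_square)
    then show "(F has_vector_derivative (1 - x / T) * cos (x * u)) (at x within {0..T})"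
      by (simp add: has_real_derivative_iff_has_vector_derivative)
  qed (use assms in simp)
  moreover have "F T - F 0 = fejer T u / 2"
    using assms False by (simp add: F_def fejer_def field_simps)
  ultimately show ?thesis by simp
qed

lemma fejer_nonneg: "T > 0 \<Longrightarrow> fejer T u \<ge> 0"
  by (simp add: fejer_def)

lemma fejer_le:
  assumes "T > 0"
  shows "fejer T u \<le> T"
proof (cases "u = 0")
  case False
  have "1 - cos (T * u) = 2 * (sin (T * u / 2))\<^sup>2"
    using cos_double_sin[of "T * u / 2"] by simp
  moreover have "(sin (T * u / 2))\<^sup>2 \<le> (T * u / 2)\<^sup>2"
    using abs_sin_x_le_abs_x[of "T * u / 2"] by (simp only: abs_le_square_iff)
  ultimately have "2 * (1 - cos (T * u)) \<le> T * (T * u\<^sup>2)"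
    by (simp add: power_mult_distrib power_divide power2_eq_square mult_ac)
  then show ?thesis using assms False by (simp add: fejer_def divide_le_eq)
qed (simp add: fejer_def)

text \<open>On the line Re s = 1 + e the series converges absolutely, so summation commutes with the
  integral representing the kernel, and the smoothed sum becomes an integral of the Dirichlet series
  along that line.\<close>

lemma sums_mangoldt_fejer:
  assumes T: "T > 0" and e: "e > 0"
  shows "(\<lambda>n. mangoldt n * real n powr (- (1 + e)) * fejer T (ln (real n) - y)) sums
     (2 * integral {0..T} (\<lambda>x. (1 - x / T) * Re (cis (x * y) * mangoldt_ser (Complex (1 + e) x))))"
proof -
  define c where "c n = mangoldt n * real n powr (- (1 + e))" for n
  have c0: "c n \<ge> 0" for n by (simp add: c_def mangoldt_nonneg)
  have summ: "summable c"
    using summable_norm_dser[OF log_bounded_mangoldt, of "Complex (1 + e) 0"] e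
    by (simp only: norm_dser_term[OF log_bounded_mangoldt]) (simp add: c_def[abs_def])
  define f where "f n x = (1 - x / T) * (c n * cos (x * (ln (real n) - y)))" for n x
  have f_le: "norm (f n x) \<le> c n" if "x \<in> {0..T}" for n x
  proof -
    have "\<bar>(1 - x / T) * cos (x * (ln (real n) - y))\<bar> \<le> 1 * 1"
      unfolding abs_mult using that T by (intro mult_mono) (auto simp: field_simps)
    from mult_left_mono[OF this c0[of n]] show ?thesis
      using c0[of n] by (simp add: f_def abs_mult mult_ac)
  qed
  have "Re (cis (x * y) * (of_real (mangoldt n) * exp (- Complex (1 + e) x * of_real (ln (real n))))) = c n * cos (x * (ln (real n) - y))" for n x
  proof (cases "n = 0")
    case False
    have "exp (- Complex (1 + e) x * of_real (ln (real n))) = of_real (real n powr (- (1 + e))) * cis (- x * ln (real n))"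
      using False by (simp add: complex_eq_iff Re_exp Im_exp powr_def algebra_simps)
    then have "cis (x * y) * (of_real (mangoldt n) * exp (- Complex (1 + e) x * of_real (ln (real n))))
      = of_real (c n) * (cis (x * y) * cis (- x * ln (real n)))" by (simp only: c_def of_real_mult mult_ac)
    also have "cis (x * y) * cis (- x * ln (real n)) = cis (- (x * (ln (real n) - y)))"
      by (simp add: cis_mult algebra_simps)
    finally show ?thesis by simp
  qed (simp add: c_def)
  then have pt: "(\<lambda>n. c n * cos (x * (ln (real n) - y))) sums Re (cis (x * y) * mangoldt_ser (Complex (1 + e) x))" for x
    using sums_Re[OF sums_mult[OF sums_dser[OF log_bounded_mangoldt, of "Complex (1 + e) x"], of "cis (x * y)"]] e
    by (simp only:) simp
  have "(\<lambda>x. \<Sum>n. f n x) = (\<lambda>x. (1 - x / T) * Re (cis (x * y) * mangoldt_ser (Complex (1 + e) x)))"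
    unfolding f_def using sums_mult[OF pt] by (intro ext sums_unique[symmetric])
  moreover have "uniform_limit {0..T} (\<lambda>N x. \<Sum>n<N. f n x) (\<lambda>x. \<Sum>n. f n x) sequentially"
    by (rule Weierstrass_m_test[OF f_le summ])
  ultimately have ul: "uniform_limit {0..T} (\<lambda>N x. \<Sum>n<N. f n x)
      (\<lambda>x. (1 - x / T) * Re (cis (x * y) * mangoldt_ser (Complex (1 + e) x))) sequentially" by simp
  have cont: "continuous_on {0..T} (\<lambda>x. \<Sum>n<N. f n x)" for N
    unfolding f_def using T by (intro continuous_intros) auto
  obtain I J where IJ: "\<And>N. ((\<lambda>x. \<Sum>n<N. f n x) has_integral I N) {0..T}"
    "((\<lambda>x. (1 - x / T) * Re (cis (x * y) * mangoldt_ser (Complex (1 + e) x))) has_integral J) {0..T}"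
    "I \<longlonglongrightarrow> J"
    by (rule uniform_limit_integral[OF ul cont sequentially_bot]) (rule that)
  have "(f n has_integral c n * (fejer T (ln (real n) - y) / 2)) {0..T}" for n
    using has_integral_mult_right[OF fejer_has_integral[OF T, of "ln (real n) - y"], of "c n"]
    by (simp add: f_def[abs_def] mult_ac)
  then have "((\<lambda>x. \<Sum>n<N. f n x) has_integral (\<Sum>n<N. c n * (fejer T (ln (real n) - y) / 2))) {0..T}" for N
    by (intro has_integral_sum) auto
  then have "I = (\<lambda>N. \<Sum>n<N. c n * (fejer T (ln (real n) - y) / 2))"
    using IJ(1) has_integral_unique by blast
  then have "(\<lambda>n. c n * (fejer T (ln (real n) - y) / 2)) sums J" using IJ(3) by (simp add: sums_def)
  from sums_mult[OF this, of 2] show ?thesis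
    using integral_unique[OF IJ(2)] by (simp add: c_def)
qed

section \<open>Boundary limits for the pole term as e tends to 0\<close>

lemma integral_poisson:
  fixes T e :: real
  assumes "T > 0" "e > 0"
  shows "((\<lambda>x. e / (e\<^sup>2 + x\<^sup>2)) has_integral arctan (T / e)) {0..T}"
proof -
  have "((\<lambda>x. e / (e\<^sup>2 + x\<^sup>2)) has_integral arctan (T / e) - arctan (0 / e)) {0..T}"
  proof (rule fundamental_theorem_of_calculus)
    fix x :: real
    have "e\<^sup>2 + x\<^sup>2 > 0" using assms by (simp add: add_pos_nonneg)
    then have "((\<lambda>x. arctan (x / e)) has_real_derivative e / (e\<^sup>2 + x\<^sup>2)) (at x within {0..T})"
      using assms by (auto intro!: derivative_eq_intros simp: field_simps power2_eq_square)
    then show "((\<lambda>x. arctan (x / e)) has_vector_derivative e / (e\<^sup>2 + x\<^sup>2)) (at x within {0..T})"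
      by (simp add: has_real_derivative_iff_has_vector_derivative)
  qed (use assms in simp)
  then show ?thesis by simp
qed

text \<open>This first moment of the Poisson kernel is O(e ln (1/e)). It measures the error of
  replacing a factor that is Lipschitz at 0 by its value there.\<close>

lemma integral_poisson_moment:
  fixes T e :: real
  assumes "T > 0" "e > 0"
  shows "((\<lambda>x. x * (e / (e\<^sup>2 + x\<^sup>2))) has_integral (e / 2 * ln (e\<^sup>2 + T\<^sup>2) - e / 2 * ln (e\<^sup>2))) {0..T}"
proof -
  have "((\<lambda>x. x * (e / (e\<^sup>2 + x\<^sup>2))) has_integral e / 2 * ln (e\<^sup>2 + T\<^sup>2) - e / 2 * ln (e\<^sup>2 + 0\<^sup>2)) {0..T}"
  proof (rule fundamental_theorem_of_calculus)
    fix x :: real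
    have "e\<^sup>2 + x\<^sup>2 > 0" using assms by (simp add: add_pos_nonneg)
    moreover have "e\<^sup>2 + x\<^sup>2 \<noteq> 0" using assms by auto
    ultimately have "((\<lambda>x. e / 2 * ln (e\<^sup>2 + x\<^sup>2)) has_real_derivative x * (e / (e\<^sup>2 + x\<^sup>2))) (at x within {0..T})"
      by (auto intro!: derivative_eq_intros simp: field_simps)
    then show "((\<lambda>x. e / 2 * ln (e\<^sup>2 + x\<^sup>2)) has_vector_derivative x * (e / (e\<^sup>2 + x\<^sup>2))) (at x within {0..T})"
      by (simp add: has_real_derivative_iff_has_vector_derivative)
  qed (use assms in simp)
  then show ?thesis by simp
qed

text \<open>The Poisson kernel is an approximate identity concentrating at 0, which is an endpoint
  of the interval, so only half of its full mass pi is collected.\<close>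

lemma tendsto_integral_poisson_cos:
  fixes T y :: real
  assumes T: "T > 0"
  shows "((\<lambda>e. integral {0..T} (\<lambda>x. (1 - x / T) * cos (x * y) * (e / (e\<^sup>2 + x\<^sup>2)))) \<longlongrightarrow> pi / 2) (at_right 0)"
proof -
  \<comment> \<open>Lipschitz constant at 0 of the weight \<open>(1 - x / T) * cos (x * y)\<close>:
    \<open>1 / T\<close> comes from the linear factor and |y| from the cosine.\<close>
  define C where "C = 1 / T + \<bar>y\<bar>"
  have bound: "\<bar>integral {0..T} (\<lambda>x. (1 - x / T) * cos (x * y) * (e / (e\<^sup>2 + x\<^sup>2))) - arctan (T / e)\<bar>
      \<le> C * (e / 2 * ln (e\<^sup>2 + T\<^sup>2) - e / 2 * ln (e\<^sup>2))" if e: "e > 0" for e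
  proof -
    have pos: "e\<^sup>2 + x\<^sup>2 > 0" for x :: real using e by (simp add: add_pos_nonneg)
    have nz: "e\<^sup>2 + x\<^sup>2 \<noteq> 0" for x :: real using e by auto
    have "(\<lambda>x. (1 - x / T) * cos (x * y) * (e / (e\<^sup>2 + x\<^sup>2))) integrable_on {0..T}"
      by (intro integrable_continuous_interval continuous_intros) (use T in simp, use nz in blast)
    from has_integral_diff[OF integrable_integral[OF this] integral_poisson[OF T e]]
    have 1: "((\<lambda>x. (1 - x / T) * cos (x * y) * (e / (e\<^sup>2 + x\<^sup>2)) - e / (e\<^sup>2 + x\<^sup>2)) has_integral
      integral {0..T} (\<lambda>x. (1 - x / T) * cos (x * y) * (e / (e\<^sup>2 + x\<^sup>2))) - arctan (T / e)) {0..T}" .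
    have 2: "((\<lambda>x. C * (x * (e / (e\<^sup>2 + x\<^sup>2)))) has_integral C * (e / 2 * ln (e\<^sup>2 + T\<^sup>2) - e / 2 * ln (e\<^sup>2))) {0..T}"
      by (intro has_integral_mult_right integral_poisson_moment T e)
    have "norm (integral {0..T} (\<lambda>x. (1 - x / T) * cos (x * y) * (e / (e\<^sup>2 + x\<^sup>2)) - e / (e\<^sup>2 + x\<^sup>2)))
       \<le> integral {0..T} (\<lambda>x. C * (x * (e / (e\<^sup>2 + x\<^sup>2))))"
    proof (rule integral_norm_bound_integral)
      fix x assume x: "x \<in> {0..T}"
      have "1 - cos (x * y) = 2 * (sin (x * y / 2))\<^sup>2" using cos_double_sin[of "x * y / 2"] by simp
      also have "\<dots> \<le> 2 * \<bar>sin (x * y / 2)\<bar>"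
        using power_decreasing[of 1 2 "\<bar>sin (x * y / 2)\<bar>"] by simp
      also have "\<dots> \<le> 2 * \<bar>x * y / 2\<bar>" using abs_sin_x_le_abs_x[of "x * y / 2"] by simp
      also have "\<dots> = x * \<bar>y\<bar>" using x by (simp add: abs_mult)
      finally have c: "1 - cos (x * y) \<le> x * \<bar>y\<bar>" .
      have "\<bar>(1 - x / T) * cos (x * y) - 1\<bar> = \<bar>(1 - cos (x * y)) + x / T * cos (x * y)\<bar>"
        by (subst abs_minus_commute) (simp add: algebra_simps)
      also have "\<dots> \<le> \<bar>1 - cos (x * y)\<bar> + \<bar>x / T * cos (x * y)\<bar>" by (rule abs_triangle_ineq)
      also have "\<dots> \<le> x * \<bar>y\<bar> + x / T * 1"
        using c x T by (intro add_mono) (auto simp: abs_mult intro!: divide_right_mono mult_left_le)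
      also have "\<dots> = C * x" by (simp add: C_def algebra_simps)
      finally have "\<bar>(1 - x / T) * cos (x * y) - 1\<bar> * (e / (e\<^sup>2 + x\<^sup>2)) \<le> C * x * (e / (e\<^sup>2 + x\<^sup>2))"
        using e pos[of x] by (intro mult_right_mono) auto
      moreover have "norm ((1 - x / T) * cos (x * y) * (e / (e\<^sup>2 + x\<^sup>2)) - e / (e\<^sup>2 + x\<^sup>2))
         = \<bar>(1 - x / T) * cos (x * y) - 1\<bar> * (e / (e\<^sup>2 + x\<^sup>2))"
      proof -
        have "(1 - x / T) * cos (x * y) * (e / (e\<^sup>2 + x\<^sup>2)) - e / (e\<^sup>2 + x\<^sup>2)
          = ((1 - x / T) * cos (x * y) - 1) * (e / (e\<^sup>2 + x\<^sup>2))" by (simp only: left_diff_distrib mult_1_left)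
        then show ?thesis using e pos[of x] by (simp only: real_norm_def abs_mult) simp
      qed
      ultimately show "norm ((1 - x / T) * cos (x * y) * (e / (e\<^sup>2 + x\<^sup>2)) - e / (e\<^sup>2 + x\<^sup>2)) \<le> C * (x * (e / (e\<^sup>2 + x\<^sup>2)))"
        by (simp only: mult.assoc)
    qed (use 1 2 in \<open>auto intro: has_integral_integrable\<close>)
    then show ?thesis using integral_unique[OF 1] integral_unique[OF 2] by simp
  qed
  have "((\<lambda>e. integral {0..T} (\<lambda>x. (1 - x / T) * cos (x * y) * (e / (e\<^sup>2 + x\<^sup>2))) - arctan (T / e)) \<longlongrightarrow> 0) (at_right 0)"
  proof (rule Lim_null_comparison)
    show "\<forall>\<^sub>F e in at_right 0. norm (integral {0..T} (\<lambda>x. (1 - x / T) * cos (x * y) * (e / (e\<^sup>2 + x\<^sup>2))) - arctan (T / e))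
       \<le> C * (e / 2 * ln (e\<^sup>2 + T\<^sup>2) - e / 2 * ln (e\<^sup>2))"
      using eventually_at_right_less[of 0] by eventually_elim (use bound in simp)
    show "((\<lambda>e. C * (e / 2 * ln (e\<^sup>2 + T\<^sup>2) - e / 2 * ln (e\<^sup>2))) \<longlongrightarrow> 0) (at_right 0)"
      using T by real_asymp
  qed
  moreover have "((\<lambda>e. arctan (T / e)) \<longlongrightarrow> pi / 2) (at_right 0)" using T by real_asymp
  ultimately show ?thesis using tendsto_add by fastforce
qed

definition sinc0 :: "real \<Rightarrow> real" where "sinc0 x = (if x = 0 then 1 else sin x / x)"

lemma continuous_on_sinc0: "continuous_on A sinc0"
  using continuous_on_subset[OF continuous_on_sinc[OF continuous_on_id[of UNIV]]]
  by (auto simp: sinc0_def[abs_def])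

lemma abs_sinc0_le: "\<bar>sinc0 x\<bar> \<le> 1"
  using abs_sin_x_le_abs_x[of x] by (auto simp: sinc0_def abs_divide divide_le_eq)

lemma mult_sinc0: "x * sinc0 x = sin x"
  by (simp add: sinc0_def)

lemma integral_sinc0:
  fixes T y :: real
  assumes T: "T > 0" and y: "y > 0"
  shows "((\<lambda>x. (1 - x / T) * (y * sinc0 (x * y))) has_integral Si (T * y) - (1 - cos (T * y)) / (T * y)) {0..T}"
proof -
  \<comment> \<open>The integrand is sin(xy)/x - sin(xy)/T, integrated term by term.\<close>
  define F where "F x = Si (x * y) + cos (x * y) / (T * y)" for x
  have "((\<lambda>x. (1 - x / T) * (y * sinc0 (x * y))) has_integral F T - F 0) {0..T}"
  proof (rule fundamental_theorem_of_calculus)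
    fix x :: real
    have Si': "(Si has_real_derivative sinc0 z) (at z)" for z
      using DERIV_Si[of z] by (simp add: sinc0_def)
    have "(F has_real_derivative sinc0 (x * y) * y - sin (x * y) / T) (at x within {0..T})"
      unfolding F_def using T y
      by (auto intro!: derivative_eq_intros DERIV_chain2[OF Si'])
    also have "sinc0 (x * y) * y - sin (x * y) / T = (1 - x / T) * (y * sinc0 (x * y))"
      using T by (subst mult_sinc0[symmetric]) (simp add: field_simps)
    finally show "(F has_vector_derivative (1 - x / T) * (y * sinc0 (x * y))) (at x within {0..T})"
      by (simp add: has_real_derivative_iff_has_vector_derivative)
  qed (use T in simp)
  moreover have "F T - F 0 = Si (T * y) - (1 - cos (T * y)) / (T * y)"
    by (simp add: F_def Si_def diff_divide_distrib zero_ereal_def[symmetric])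
  ultimately show ?thesis by simp
qed

text \<open>The limiting kernel 1/x is harmless because sin(xy)/x stays bounded. Replacing x / (e^2
  + x^2) by it costs at most y e times the Poisson kernel.\<close>

lemma tendsto_integral_conj_poisson_sin:
  fixes T y :: real
  assumes T: "T > 0" and y: "y > 0"
  shows "((\<lambda>e. integral {0..T} (\<lambda>x. (1 - x / T) * sin (x * y) * (x / (e\<^sup>2 + x\<^sup>2)))) \<longlongrightarrow>
     Si (T * y) - (1 - cos (T * y)) / (T * y)) (at_right 0)"
proof -
  define S where "S = Si (T * y) - (1 - cos (T * y)) / (T * y)"
  have bound: "\<bar>integral {0..T} (\<lambda>x. (1 - x / T) * sin (x * y) * (x / (e\<^sup>2 + x\<^sup>2))) - S\<bar>
      \<le> y * e * arctan (T / e)" if e: "e > 0" for e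
  proof -
    have pos: "e\<^sup>2 + x\<^sup>2 > 0" for x :: real using e by (simp add: add_pos_nonneg)
    have nz: "e\<^sup>2 + x\<^sup>2 \<noteq> 0" for x :: real using e by auto
    have "(\<lambda>x. (1 - x / T) * sin (x * y) * (x / (e\<^sup>2 + x\<^sup>2))) integrable_on {0..T}"
      by (intro integrable_continuous_interval continuous_intros) (use T in simp, use nz in blast)
    from has_integral_diff[OF integrable_integral[OF this] integral_sinc0[OF T y]]
    have 1: "((\<lambda>x. (1 - x / T) * sin (x * y) * (x / (e\<^sup>2 + x\<^sup>2)) - (1 - x / T) * (y * sinc0 (x * y))) has_integral
      integral {0..T} (\<lambda>x. (1 - x / T) * sin (x * y) * (x / (e\<^sup>2 + x\<^sup>2))) - S) {0..T}" by (simp only: S_def)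
    have 2: "((\<lambda>x. y * e * (e / (e\<^sup>2 + x\<^sup>2))) has_integral y * e * arctan (T / e)) {0..T}"
      by (intro has_integral_mult_right integral_poisson T e)
    have "norm (integral {0..T} (\<lambda>x. (1 - x / T) * sin (x * y) * (x / (e\<^sup>2 + x\<^sup>2)) - (1 - x / T) * (y * sinc0 (x * y))))
       \<le> integral {0..T} (\<lambda>x. y * e * (e / (e\<^sup>2 + x\<^sup>2)))"
    proof (rule integral_norm_bound_integral)
      fix x assume x: "x \<in> {0..T}"
      have "(1 - x / T) * sin (x * y) * (x / (e\<^sup>2 + x\<^sup>2)) - (1 - x / T) * (y * sinc0 (x * y))
         = (1 - x / T) * sinc0 (x * y) * (y * (x\<^sup>2 / (e\<^sup>2 + x\<^sup>2) - 1))"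
      proof -
        have "w * (x * y * q) * (x / D) - w * (y * q) = w * q * (y * (x\<^sup>2 / D - 1))" for w q D :: real
          by (simp add: algebra_simps power2_eq_square)
        then show ?thesis by (subst mult_sinc0[symmetric])
      qed
      also have "x\<^sup>2 / (e\<^sup>2 + x\<^sup>2) - 1 = - (e * (e / (e\<^sup>2 + x\<^sup>2)))"
        using nz[of x] by (simp add: field_simps power2_eq_square)
      finally have "norm ((1 - x / T) * sin (x * y) * (x / (e\<^sup>2 + x\<^sup>2)) - (1 - x / T) * (y * sinc0 (x * y)))
         = \<bar>(1 - x / T) * sinc0 (x * y)\<bar> * (y * e * (e / (e\<^sup>2 + x\<^sup>2)))"
        using y e pos[of x] by (simp add: abs_mult)
      also have "\<dots> \<le> 1 * (y * e * (e / (e\<^sup>2 + x\<^sup>2)))"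
      proof (rule mult_right_mono)
        show "\<bar>(1 - x / T) * sinc0 (x * y)\<bar> \<le> 1"
          unfolding abs_mult using x T abs_sinc0_le[of "x * y"] by (intro mult_le_one) (auto simp: field_simps)
        show "0 \<le> y * e * (e / (e\<^sup>2 + x\<^sup>2))" using y e pos[of x] by simp
      qed
      finally show "norm ((1 - x / T) * sin (x * y) * (x / (e\<^sup>2 + x\<^sup>2)) - (1 - x / T) * (y * sinc0 (x * y))) \<le> y * e * (e / (e\<^sup>2 + x\<^sup>2))"
        by simp
    qed (use 1 2 in \<open>auto intro: has_integral_integrable\<close>)
    then show ?thesis using integral_unique[OF 1] integral_unique[OF 2] by simp
  qed
  have "((\<lambda>e. integral {0..T} (\<lambda>x. (1 - x / T) * sin (x * y) * (x / (e\<^sup>2 + x\<^sup>2))) - S) \<longlongrightarrow> 0) (at_right 0)"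
  proof (rule Lim_null_comparison)
    show "\<forall>\<^sub>F e in at_right 0. norm (integral {0..T} (\<lambda>x. (1 - x / T) * sin (x * y) * (x / (e\<^sup>2 + x\<^sup>2))) - S)
       \<le> y * e * arctan (T / e)"
      using eventually_at_right_less[of 0] by eventually_elim (use bound in simp)
    show "((\<lambda>e. y * e * arctan (T / e)) \<longlongrightarrow> 0) (at_right 0)"
      using T by real_asymp
  qed
  then show ?thesis unfolding S_def[symmetric] by (simp add: LIM_zero_iff)
qed

section \<open>Contribution of the holomorphic part\<close>

text \<open>One integration by parts gives the rate O(1/y), with a constant made of the boundary
  values and the integral of the derivative.\<close>

lemma Riemann_Lebesgue_C1:
  fixes \<phi> :: "real \<Rightarrow> complex"
  assumes T: "T \<ge> 0" and d: "\<And>x. x \<in> {0..T} \<Longrightarrow> (\<phi> has_vector_derivative \<phi>' x) (at x within {0..T})"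
    and c: "continuous_on {0..T} \<phi>'"
  shows "((\<lambda>y. integral {0..T} (\<lambda>x. cis (x * y) * \<phi> x)) \<longlongrightarrow> 0) at_top"
proof (rule Lim_null_comparison)
  define C where "C = norm (\<phi> T) + norm (\<phi> 0) + integral {0..T} (\<lambda>x. norm (\<phi>' x))"
  show "((\<lambda>y. C / y) \<longlongrightarrow> 0) at_top" by real_asymp
  have c\<phi>: "continuous_on {0..T} \<phi>"
    using d has_vector_derivative_continuous continuous_on_eq_continuous_within by blast
  show "\<forall>\<^sub>F y in at_top. norm (integral {0..T} (\<lambda>x. cis (x * y) * \<phi> x)) \<le> C / y"
    using eventually_gt_at_top[of 0]
  proof eventually_elim
    case (elim y)
    define I where "I = integral {0..T} (\<lambda>x. cis (x * y) * \<phi> x)"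
    define J where "J = integral {0..T} (\<lambda>x. cis (x * y) * \<phi>' x)"
    have I: "((\<lambda>x. cis (x * y) * \<phi> x) has_integral I) {0..T}"
      unfolding I_def by (intro integrable_integral integrable_continuous_interval continuous_intros c\<phi>)
    have J: "((\<lambda>x. cis (x * y) * \<phi>' x) has_integral J) {0..T}"
      unfolding J_def by (intro integrable_integral integrable_continuous_interval continuous_intros c)
    have "((\<lambda>x. cis (x * y) * \<phi>' x + \<i> * of_real y * (cis (x * y) * \<phi> x)) has_integral
       cis (T * y) * \<phi> T - cis (0 * y) * \<phi> 0) {0..T}"
    proof (rule fundamental_theorem_of_calculus[OF T])
      fix x assume x: "x \<in> {0..T}"
      have "((\<lambda>x. cis (x * y)) has_vector_derivative \<i> * of_real y * cis (x * y)) (at x within {0..T})"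
      proof -
        have "((\<lambda>z. exp (\<i> * of_real y * z)) has_field_derivative \<i> * of_real y * exp (\<i> * of_real y * of_real x)) (at (of_real x))"
          by (auto intro!: derivative_eq_intros)
        from has_vector_derivative_real_field[OF this] show ?thesis
          by (simp add: cis_conv_exp mult_ac)
      qed
      from has_vector_derivative_mult[OF this d[OF x]]
      show "((\<lambda>x. cis (x * y) * \<phi> x) has_vector_derivative cis (x * y) * \<phi>' x + \<i> * of_real y * (cis (x * y) * \<phi> x)) (at x within {0..T})"
        by (simp add: mult.assoc)
    qed
    moreover have "((\<lambda>x. cis (x * y) * \<phi>' x + \<i> * of_real y * (cis (x * y) * \<phi> x)) has_integral J + \<i> * of_real y * I) {0..T}"
      by (intro has_integral_add has_integral_mult_right I J)
    ultimately have "J + \<i> * of_real y * I = cis (T * y) * \<phi> T - cis (0 * y) * \<phi> 0"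
      using has_integral_unique by blast
    then have "\<i> * of_real y * I = cis (T * y) * \<phi> T - cis (0 * y) * \<phi> 0 - J" by (simp add: algebra_simps)
    then have "norm (\<i> * of_real y * I) \<le> norm (cis (T * y) * \<phi> T) + norm (cis (0 * y) * \<phi> 0) + norm J"
      by (metis norm_triangle_ineq4 norm_triangle_ineq4[THEN order_trans] add_right_mono)
    moreover have "norm J \<le> integral {0..T} (\<lambda>x. norm (\<phi>' x))"
      unfolding J_def
      by (intro integral_norm_bound_integral integrable_continuous_interval continuous_intros c) (simp add: norm_mult)
    ultimately have "y * norm I \<le> C" using elim by (simp add: norm_mult C_def)
    then have "norm I \<le> C / y" using elim by (simp add: pos_le_divide_eq mult.commute)
    then show ?case by (simp only: I_def)
  qed
qed

text \<open>Holomorphy across Re z = 0 makes the integrand jointly continuous for e \<ge> 0, so the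
  limit passes inside the integral.\<close>

lemma tendsto_integral_extension:
  assumes T: "T > 0" and U: "open U" "{z. Re z \<ge> 0} \<subseteq> U" "g holomorphic_on U"
  shows "((\<lambda>e. integral {0..T} (\<lambda>x. (1 - x / T) * Re (cis (x * y) * g (Complex e x)))) \<longlongrightarrow>
      integral {0..T} (\<lambda>x. (1 - x / T) * Re (cis (x * y) * g (Complex 0 x)))) (at_right 0)"
proof -
  have "continuous_on ({0..} \<times> cbox 0 T) (\<lambda>(e, x). (1 - x / T) * Re (cis (x * y) * g (Complex e x)))"
    unfolding case_prod_unfold Complex_eq
    by (intro continuous_intros continuous_on_compose2[OF holomorphic_on_imp_continuous_on[OF U(3)]]) (use T U(2) in auto)
  from integral_continuous_on_param[OF this]
  have "continuous_on {0..} (\<lambda>e. integral {0..T} (\<lambda>x. (1 - x / T) * Re (cis (x * y) * g (Complex e x))))" by simp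
  then have "((\<lambda>e. integral {0..T} (\<lambda>x. (1 - x / T) * Re (cis (x * y) * g (Complex e x)))) \<longlongrightarrow>
      integral {0..T} (\<lambda>x. (1 - x / T) * Re (cis (x * y) * g (Complex 0 x)))) (at 0 within {0..})"
    by (simp add: continuous_on_def)
  then show ?thesis by (rule tendsto_within_subset) auto
qed

lemma tendsto_integral_extension_at_top:
  assumes T: "T > 0" and U: "open U" "{z. Re z \<ge> 0} \<subseteq> U" "g holomorphic_on U"
  shows "((\<lambda>y. integral {0..T} (\<lambda>x. (1 - x / T) * Re (cis (x * y) * g (Complex 0 x)))) \<longlongrightarrow> 0) at_top"
proof -
  \<comment> \<open>The complex amplitude on the imaginary axis; the real part is taken only after
    the Riemann-Lebesgue lemma has been applied.\<close>
  define \<phi> where "\<phi> x = of_real (1 - x / T) * g (\<i> * of_real x)" for x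
  define \<phi>' where "\<phi>' x = of_real (1 - x / T) * (\<i> * deriv g (\<i> * of_real x)) + of_real (- 1 / T) * g (\<i> * of_real x)" for x
  have mem: "\<i> * of_real x \<in> U" for x using U(2) by auto
  have cg: "continuous_on {0..T} (\<lambda>x. g (\<i> * of_real x))"
    by (intro continuous_on_compose2[OF holomorphic_on_imp_continuous_on[OF U(3)]] continuous_intros) (use mem in auto)
  have cg': "continuous_on {0..T} (\<lambda>x. deriv g (\<i> * of_real x))"
    by (intro continuous_on_compose2[OF holomorphic_on_imp_continuous_on[OF holomorphic_deriv[OF U(3,1)]]] continuous_intros) (use mem in auto)
  have d: "(\<phi> has_vector_derivative \<phi>' x) (at x within {0..T})" for x
  proof -
    have "((\<lambda>z. g (\<i> * z)) has_field_derivative deriv g (\<i> * of_real x) * \<i>) (at (of_real x))"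
      by (rule DERIV_chain2[where g="\<lambda>z. \<i> * z", OF holomorphic_derivI[OF U(3,1) mem]]) (auto intro!: derivative_eq_intros)
    from has_vector_derivative_real_field[OF this]
    have 1: "((\<lambda>x. g (\<i> * of_real x)) has_vector_derivative \<i> * deriv g (\<i> * of_real x)) (at x within {0..T})"
      by (simp add: mult.commute)
    have "((\<lambda>x. 1 - x / T) has_real_derivative - 1 / T) (at x within {0..T})"
      using T by (auto intro!: derivative_eq_intros)
    then have 2: "((\<lambda>x. complex_of_real (1 - x / T)) has_vector_derivative of_real (- 1 / T)) (at x within {0..T})"
      by (intro has_vector_derivative_of_real) (simp add: has_real_derivative_iff_has_vector_derivative)
    show ?thesis unfolding \<phi>_def \<phi>'_def by (rule has_vector_derivative_mult[OF 2 1])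
  qed
  have c: "continuous_on {0..T} \<phi>'"
    unfolding \<phi>'_def by (intro continuous_intros cg cg') (use T in auto)
  have c\<phi>: "continuous_on {0..T} \<phi>"
    unfolding \<phi>_def by (intro continuous_intros cg) (use T in auto)
  have "((\<lambda>y. Re (integral {0..T} (\<lambda>x. cis (x * y) * \<phi> x))) \<longlongrightarrow> Re 0) at_top"
    by (intro tendsto_Re Riemann_Lebesgue_C1[OF _ d c]) (use T in auto)
  moreover have "Re (integral {0..T} (\<lambda>x. cis (x * y) * \<phi> x)) =
      integral {0..T} (\<lambda>x. (1 - x / T) * Re (cis (x * y) * g (Complex 0 x)))" for y
  proof -
    have "((\<lambda>x. Re (cis (x * y) * \<phi> x)) has_integral Re (integral {0..T} (\<lambda>x. cis (x * y) * \<phi> x))) {0..T}"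
      by (intro has_integral_Re integrable_integral integrable_continuous_interval continuous_intros c\<phi>)
    moreover have "Re (cis (x * y) * \<phi> x) = (1 - x / T) * Re (cis (x * y) * g (Complex 0 x))" for x
    proof -
      have "cis (x * y) * \<phi> x = of_real (1 - x / T) * (cis (x * y) * g (Complex 0 x))"
        by (simp only: \<phi>_def Complex_eq of_real_0 add_0_left mult_ac)
      moreover have "Re (of_real a * z) = a * Re z" for a z by simp
      ultimately show ?thesis by (simp only:)
    qed
    ultimately show ?thesis by (simp only: integral_unique)
  qed
  ultimately show ?thesis by simp
qed

section \<open>Asymptotics of the smoothed sums\<close>

text \<open>Let e tend to 0 in the identity on Re s = 1 + e. The real part involving the pole 1 / (e
  + ix) splits into the Poisson kernel and its conjugate, which give pi/2 and the sine-integral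
  term. On the side of the series the terms are nonnegative and bounded by their limits, which
  justifies the exchange.\<close>

lemma mangoldt_fejer_sums:
  assumes T: "T > 0" and y: "y > 0"
    and U: "open U" "{z. Re z \<ge> 0} \<subseteq> U" "g holomorphic_on U"
    and g: "\<And>z. Re z > 0 \<Longrightarrow> mangoldt_ser (1 + z) = 1 / z + g z"
  shows "(\<lambda>n. mangoldt n / real n * fejer T (ln (real n) - y)) sums
    (2 * (pi / 2 + (Si (T * y) - (1 - cos (T * y)) / (T * y)) +
       integral {0..T} (\<lambda>x. (1 - x / T) * Re (cis (x * y) * g (Complex 0 x)))))"
    (is "?a sums ?L")
proof -
  define b where "b e n = mangoldt n * real n powr (- (1 + e)) * fejer T (ln (real n) - y)" for e n
  define R where "R e = 2 * (integral {0..T} (\<lambda>x. (1 - x / T) * cos (x * y) * (e / (e\<^sup>2 + x\<^sup>2)))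
      + integral {0..T} (\<lambda>x. (1 - x / T) * sin (x * y) * (x / (e\<^sup>2 + x\<^sup>2)))
      + integral {0..T} (\<lambda>x. (1 - x / T) * Re (cis (x * y) * g (Complex e x))))" for e
  have R_lim: "(R \<longlongrightarrow> ?L) (at_right 0)"
    unfolding R_def by (intro tendsto_intros tendsto_integral_poisson_cos tendsto_integral_conj_poisson_sin
        tendsto_integral_extension[OF T U] T y)
  have b_sums: "b e sums R e" if e: "e > 0" for e
  proof -
    have nz: "e\<^sup>2 + x\<^sup>2 \<noteq> 0" for x :: real using e by auto
    have cg: "continuous_on {0..T} (\<lambda>x. g (Complex e x))"
      unfolding Complex_eq
      by (intro continuous_on_compose2[OF holomorphic_on_imp_continuous_on[OF U(3)]] continuous_intros) (use U(2) e in auto)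
    have pt: "(1 - x / T) * Re (cis (x * y) * mangoldt_ser (Complex (1 + e) x)) =
       (1 - x / T) * cos (x * y) * (e / (e\<^sup>2 + x\<^sup>2)) + (1 - x / T) * sin (x * y) * (x / (e\<^sup>2 + x\<^sup>2))
        + (1 - x / T) * Re (cis (x * y) * g (Complex e x))" for x
    proof -
      have "Complex (1 + e) x = 1 + Complex e x" by (simp add: complex_eq_iff)
      then have "mangoldt_ser (Complex (1 + e) x) = 1 / Complex e x + g (Complex e x)" using g[of "Complex e x"] e by simp
      moreover have "Re (cis (x * y) * (1 / Complex e x)) = cos (x * y) * (e / (e\<^sup>2 + x\<^sup>2)) + sin (x * y) * (x / (e\<^sup>2 + x\<^sup>2))"
        by (simp add: Re_divide Im_divide add_divide_distrib)
      ultimately have "Re (cis (x * y) * mangoldt_ser (Complex (1 + e) x)) =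
        cos (x * y) * (e / (e\<^sup>2 + x\<^sup>2)) + sin (x * y) * (x / (e\<^sup>2 + x\<^sup>2)) + Re (cis (x * y) * g (Complex e x))"
        by (simp only: distrib_left plus_complex.sel)
      then show ?thesis by (simp only: distrib_left mult.assoc)
    qed
    have "integral {0..T} (\<lambda>x. (1 - x / T) * Re (cis (x * y) * mangoldt_ser (Complex (1 + e) x))) =
      integral {0..T} (\<lambda>x. (1 - x / T) * cos (x * y) * (e / (e\<^sup>2 + x\<^sup>2)))
      + integral {0..T} (\<lambda>x. (1 - x / T) * sin (x * y) * (x / (e\<^sup>2 + x\<^sup>2)))
      + integral {0..T} (\<lambda>x. (1 - x / T) * Re (cis (x * y) * g (Complex e x)))"
      unfolding pt
    proof (intro integral_unique has_integral_add integrable_integral integrable_continuous_interval)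
      show "continuous_on {0..T} (\<lambda>x. (1 - x / T) * cos (x * y) * (e / (e\<^sup>2 + x\<^sup>2)))"
        by (intro continuous_intros) (use T in simp, use nz in blast)
      show "continuous_on {0..T} (\<lambda>x. (1 - x / T) * sin (x * y) * (x / (e\<^sup>2 + x\<^sup>2)))"
        by (intro continuous_intros) (use T in simp, use nz in blast)
      show "continuous_on {0..T} (\<lambda>x. (1 - x / T) * Re (cis (x * y) * g (Complex e x)))"
        by (intro continuous_intros cg) (use T in simp)
    qed
    then show ?thesis using sums_mangoldt_fejer[OF T e, of y] by (simp only: b_def[abs_def] R_def)
  qed
  have b_nonneg: "0 \<le> b e n" for e n
    using T by (simp add: b_def mangoldt_nonneg fejer_nonneg)
  have a_nonneg: "0 \<le> ?a n" for n
    using T by (simp add: mangoldt_nonneg fejer_nonneg)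
  have b_le: "b e n \<le> ?a n" if "e > 0" for e n
  proof (cases "n = 0")
    case False
    then have "real n powr (- (1 + e)) \<le> real n powr (-1)" using that by (intro powr_mono) auto
    also have "\<dots> = 1 / real n" using False by (simp add: powr_minus_divide)
    finally have "mangoldt n * real n powr (- (1 + e)) \<le> mangoldt n * (1 / real n)"
      by (rule mult_left_mono) (rule mangoldt_nonneg)
    from mult_right_mono[OF this fejer_nonneg[OF T]] show ?thesis by (simp add: b_def)
  qed (simp add: b_def)
  have b_lim: "((\<lambda>e. b e n) \<longlongrightarrow> ?a n) (at_right 0)" for n
  proof (cases "n = 0")
    case False
    then have "((\<lambda>e. b e n) \<longlongrightarrow> b 0 n) (at_right 0)"
      unfolding b_def by (intro tendsto_intros) auto
    also have "b 0 n = ?a n" using False by (simp add: b_def powr_minus_divide)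
    finally show ?thesis .
  qed (simp add: b_def)
  \<comment> \<open>Partial sums pass to the limit, which yields summability and one inequality; the
    reverse one holds because \<open>b e n\<close> never exceeds its limit.\<close>
  have part: "(\<Sum>n<N. ?a n) \<le> ?L" for N
  proof (rule tendsto_le[OF _ R_lim])
    show "((\<lambda>e. \<Sum>n<N. b e n) \<longlongrightarrow> (\<Sum>n<N. ?a n)) (at_right 0)" by (intro tendsto_sum b_lim)
    show "\<forall>\<^sub>F e in at_right 0. (\<Sum>n<N. b e n) \<le> R e"
      using eventually_at_right_less[of 0]
    proof eventually_elim
      case (elim e)
      then show ?case using b_sums[OF elim] sum_le_suminf[of "b e" "{..<N}"] b_nonneg by (simp add: sums_iff)
    qed
  qed simp
  then have summ: "summable ?a" using a_nonneg by (intro summableI_nonneg_bounded) auto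
  have "suminf ?a \<le> ?L" using summ part by (intro suminf_le_const) auto
  moreover have "?L \<le> suminf ?a"
  proof (rule tendsto_upperbound[OF R_lim])
    show "\<forall>\<^sub>F e in at_right 0. R e \<le> suminf ?a"
      using eventually_at_right_less[of 0]
    proof eventually_elim
      case (elim e)
      then show ?case using b_sums[OF elim] b_le summ suminf_le[of "b e" ?a] by (simp add: sums_iff)
    qed
  qed simp
  ultimately show ?thesis using summ by (simp add: sums_iff)
qed

definition fejer_mass :: "real \<Rightarrow> real \<Rightarrow> real" where
  "fejer_mass T y = (\<Sum>n. mangoldt n / real n * fejer T (ln (real n) - y))"

lemma summable_fejer_mass:
  assumes "T > 0" "y > 0"
  shows "summable (\<lambda>n. mangoldt n / real n * fejer T (ln (real n) - y))"
proof -
  obtain U g where "open U" "{z. Re z \<ge> 0} \<subseteq> U" "g holomorphic_on U"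
    "\<And>z. Re z > 0 \<Longrightarrow> mangoldt_ser (1 + z) = 1 / z + g z"
    by (rule mangoldt_ser_extension) (rule that)
  from mangoldt_fejer_sums[OF assms this] show ?thesis by (rule sums_summable)
qed

text \<open>The Poisson term and the sine integral account for pi/2 each and the holomorphic part
  for 0. Doubling gives the full mass of the kernel, as for a measure of density 1 on the
  logarithmic scale.\<close>

lemma tendsto_fejer_mass:
  assumes T: "T > 0"
  shows "(fejer_mass T \<longlongrightarrow> 2 * pi) at_top"
proof -
  obtain U g where U: "open U" "{z. Re z \<ge> 0} \<subseteq> U" "g holomorphic_on U"
    and g: "\<And>z. Re z > 0 \<Longrightarrow> mangoldt_ser (1 + z) = 1 / z + g z"
    by (rule mangoldt_ser_extension) (rule that)
  have "((\<lambda>y. 2 * (pi / 2 + (Si (T * y) - (1 - cos (T * y)) / (T * y)) +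
       integral {0..T} (\<lambda>x. (1 - x / T) * Re (cis (x * y) * g (Complex 0 x))))) \<longlongrightarrow> 2 * (pi / 2 + (pi / 2 - 0) + 0)) at_top"
  proof (intro tendsto_intros tendsto_integral_extension_at_top[OF T U])
    show "((\<lambda>y. Si (T * y)) \<longlongrightarrow> pi / 2) at_top"
      by (rule filterlim_compose[OF Si_at_top]) (use T in real_asymp)
    show "((\<lambda>y. (1 - cos (T * y)) / (T * y)) \<longlongrightarrow> 0) at_top"
    proof (rule Lim_null_comparison)
      show "((\<lambda>y. 2 / (T * y)) \<longlongrightarrow> 0) at_top" using T by real_asymp
      show "\<forall>\<^sub>F y in at_top. norm ((1 - cos (T * y)) / (T * y)) \<le> 2 / (T * y)"
        using eventually_gt_at_top[of 0]
      proof eventually_elim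
        case (elim y)
        have "\<bar>1 - cos (T * y)\<bar> \<le> 2" using cos_ge_minus_one[of "T * y"] cos_le_one[of "T * y"] by linarith
        then show ?case using elim T by (simp add: abs_mult divide_right_mono)
      qed
    qed
  qed
  then have "((\<lambda>y. 2 * (pi / 2 + (Si (T * y) - (1 - cos (T * y)) / (T * y)) +
       integral {0..T} (\<lambda>x. (1 - x / T) * Re (cis (x * y) * g (Complex 0 x))))) \<longlongrightarrow> 2 * pi) at_top" by simp
  moreover have "\<forall>\<^sub>F y in at_top. 2 * (pi / 2 + (Si (T * y) - (1 - cos (T * y)) / (T * y)) +
       integral {0..T} (\<lambda>x. (1 - x / T) * Re (cis (x * y) * g (Complex 0 x)))) = fejer_mass T y"
    using eventually_gt_at_top[of 0]
    by eventually_elim (use mangoldt_fejer_sums[OF T _ U g] in \<open>simp add: fejer_mass_def sums_iff\<close>)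
  ultimately show ?thesis by (rule Lim_transform_eventually)
qed

section \<open>Primes in short intervals\<close>

text \<open>The kernel at \<open>T = 1\<close> vanishes periodically, but \<open>(1 - cos u) + (1 - cos (u + \<pi>)) = 2\<close>, so it dominates
  \<open>1 / u\<^sup>2\<close> together with its shift. This bounds tails without a Chebyshev estimate.\<close>

lemma fejer_le_shifted_sum:
  assumes T: "T > 0" and d: "d > 0" and u: "\<bar>u\<bar> > d"
  shows "fejer T u \<le> (1 + pi / d)\<^sup>2 / T * (fejer 1 u + fejer 1 (u + pi))"
proof -
  define C where "C = (1 + pi / d)\<^sup>2"
  have u0: "u \<noteq> 0" using u d by auto
  have "(1::real)\<^sup>2 \<le> (1 + pi / d)\<^sup>2" using d by (intro power_mono) auto
  then have C1: "C \<ge> 1" by (simp add: C_def)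
  have "fejer T u \<le> 4 / (T * u\<^sup>2)"
  proof -
    have "1 - cos (T * u) \<le> 2" using cos_ge_minus_one[of "T * u"] by linarith
    then have "2 * (1 - cos (T * u)) \<le> 2 * 2" by (rule mult_left_mono) simp
    from divide_right_mono[OF this, of "T * u\<^sup>2"] show ?thesis using u0 T by (simp add: fejer_def)
  qed
  also have "\<dots> \<le> C / T * (fejer 1 u + fejer 1 (u + pi))"
  proof -
    have "4 / u\<^sup>2 \<le> C * (fejer 1 u + fejer 1 (u + pi))"
    proof (cases "u + pi = 0")
      \<comment> \<open>Here the shifted kernel takes its special value at 0, but the unshifted one
        already equals 4 / u^2.\<close>
      case True
      then have "u = - pi" by simp
      then have "fejer 1 u = 4 / u\<^sup>2" by (simp add: fejer_def)
      then have "4 / u\<^sup>2 \<le> 1 * (fejer 1 u + fejer 1 (u + pi))" using True by (simp add: fejer_def)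
      also have "\<dots> \<le> C * (fejer 1 u + fejer 1 (u + pi))"
        using C1 by (intro mult_right_mono add_nonneg_nonneg fejer_nonneg) auto
      finally show ?thesis .
    next
      case False
      \<comment> \<open>Outside the window the shift by pi enlarges |u| by a factor of at most 1 +
        pi/d, which is the source of \<open>C\<close>. Since cos (u + pi) = - cos u, the two
        numerators add up to 4.\<close>
      have "\<bar>u + pi\<bar> \<le> \<bar>u\<bar> + pi" using pi_gt_zero by linarith
      also have "\<dots> \<le> (1 + pi / d) * \<bar>u\<bar>"
      proof -
        have "pi / d * d \<le> pi / d * \<bar>u\<bar>" using u d by (intro mult_left_mono) auto
        then show ?thesis using d by (simp add: distrib_right)
      qed
      finally have "\<bar>u + pi\<bar>\<^sup>2 \<le> ((1 + pi / d) * \<bar>u\<bar>)\<^sup>2" by (intro power_mono) auto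
      then have le: "(u + pi)\<^sup>2 \<le> C * u\<^sup>2" by (simp add: C_def power_mult_distrib)
      have "2 * (1 + cos u) / u\<^sup>2 = C * (2 * (1 + cos u) / (C * u\<^sup>2))" using C1 by simp
      also have "\<dots> \<le> C * (2 * (1 + cos u) / (u + pi)\<^sup>2)"
      proof -
        have "0 \<le> 1 + cos u" using cos_ge_minus_one[of u] by linarith
        then have "0 \<le> 2 * (1 + cos u)" by (intro mult_nonneg_nonneg) auto
        moreover have "0 < (C * u\<^sup>2) * (u + pi)\<^sup>2" using C1 u0 False by simp
        ultimately show ?thesis using C1 le by (intro mult_left_mono divide_left_mono) auto
      qed
      also have "\<dots> = C * fejer 1 (u + pi)" using False by (simp add: fejer_def cos_add)
      finally have "2 * (1 + cos u) / u\<^sup>2 \<le> C * fejer 1 (u + pi)" .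
      moreover have "2 * (1 - cos u) / u\<^sup>2 \<le> C * fejer 1 u"
        using mult_right_mono[OF C1 fejer_nonneg[of 1 u]] u0 by (simp add: fejer_def)
      moreover have "4 / u\<^sup>2 = 2 * (1 + cos u) / u\<^sup>2 + 2 * (1 - cos u) / u\<^sup>2"
        by (simp flip: add_divide_distrib)
      ultimately show ?thesis by (simp add: distrib_left)
    qed
    from divide_right_mono[OF this, of T] show ?thesis using T by (simp add: mult.commute)
  qed
  finally show ?thesis unfolding C_def .
qed

text \<open>If p^k \<le> x with k \<ge> 2, then p \<le> sqrt x, and p \<ge> 2 bounds k by the binary
  logarithm of x. It remains to count pairs (p, k).\<close>

lemma card_proper_prime_powers_le:
  assumes "x \<ge> (1::real)"
  shows "real (card {n. primepow n \<and> \<not> prime n \<and> real n \<le> x}) \<le> (sqrt x + 1) * (log 2 x + 1)"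
proof -
  define A where "A = nat \<lfloor>sqrt x\<rfloor>"
  define B where "B = nat \<lfloor>log 2 x\<rfloor>"
  have "{n. primepow n \<and> \<not> prime n \<and> real n \<le> x} \<subseteq> (\<lambda>(p, k). p ^ k) ` ({..A} \<times> {..B})"
  proof
    fix n assume "n \<in> {n. primepow n \<and> \<not> prime n \<and> real n \<le> x}"
    then have n: "primepow n" "\<not> prime n" "real n \<le> x" by auto
    then obtain p k where pk: "prime p" "k > 0" "n = p ^ k" by (auto simp: primepow_def)
    then have "k \<noteq> 1" using n(2) by auto
    then have k: "k \<ge> 2" using pk(2) by simp
    have p: "p \<ge> 2" using pk(1) prime_ge_2_nat by auto
    have "real p ^ 2 \<le> real p ^ k" using k p by (intro power_increasing) auto
    also have "\<dots> \<le> x" using n(3) pk(3) by simp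
    finally have "real p \<le> sqrt x" using real_le_rsqrt by blast
    then have "p \<le> A" by (simp add: A_def le_nat_floor)
    moreover have "(2::real) ^ k \<le> real p ^ k" using p by (intro power_mono) auto
    then have "2 powr real k \<le> x" using n(3) pk(3) by (simp add: powr_realpow)
    then have "real k \<le> log 2 x" using assms by (simp add: le_log_iff)
    then have "k \<le> B" by (simp add: B_def le_nat_floor)
    ultimately show "n \<in> (\<lambda>(p, k). p ^ k) ` ({..A} \<times> {..B})" using pk(3) by auto
  qed
  then have "card {n. primepow n \<and> \<not> prime n \<and> real n \<le> x} \<le> card ({..A} \<times> {..B})"
    by (rule surj_card_le[rotated]) simp
  also have "\<dots> = (A + 1) * (B + 1)" by (simp add: card_cartesian_product)
  finally have "real (card {n. primepow n \<and> \<not> prime n \<and> real n \<le> x}) \<le> (real A + 1) * (real B + 1)"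
    by (metis of_nat_1 of_nat_add of_nat_le_iff of_nat_mult)
  also have "\<dots> \<le> (sqrt x + 1) * (log 2 x + 1)"
    using assms by (intro mult_mono) (auto simp: A_def B_def)
  finally show ?thesis .
qed

text \<open>The window around y carries a fixed positive share of the smoothed mass, and proper
  prime powers are too sparse to account for it.\<close>

lemma eventually_prime_near_exp:
  assumes d: "d > 0"
  shows "\<forall>\<^sub>F y in at_top. \<exists>p. prime p \<and> \<bar>ln (real p) - y\<bar> \<le> d"
proof -
  define C where "C = (1 + pi / d)\<^sup>2"
  \<comment> \<open>With T = 4 C the limiting bound for the tail is (C/T) (2 pi + 2 pi) = pi, half
    of the main mass 2 pi.\<close>
  define T where "T = 4 * C"
  have "(1::real)\<^sup>2 \<le> (1 + pi / d)\<^sup>2" using d by (intro power_mono) auto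
  then have C1: "C \<ge> 1" by (simp add: C_def)
  then have T: "T > 0" by (simp add: T_def)
  define W where "W y = {n. n > 0 \<and> \<bar>ln (real n) - y\<bar> \<le> d}" for y
  have W_mem: "exp (y - d) \<le> real n \<and> real n \<le> exp (y + d)" if "n \<in> W y" for n y
  proof -
    have "y - d \<le> ln (real n)" "ln (real n) \<le> y + d" "real n > 0" using that by (auto simp: W_def)
    then show ?thesis using exp_le_cancel_iff exp_ln by metis
  qed
  have fin: "finite (W y)" for y
  proof (rule finite_subset)
    show "W y \<subseteq> {..nat \<lfloor>exp (y + d)\<rfloor>}" using W_mem by (auto simp: le_nat_floor)
  qed simp
  have main: "fejer_mass T y \<le> (\<Sum>n\<in>W y. mangoldt n / real n) * T + C / T * (fejer_mass 1 y + fejer_mass 1 (y - pi))"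
    if y: "y > pi" for y
  proof -
    define a where "a n = (mangoldt n / real n :: real)" for n
    have a: "a n \<ge> 0" for n by (simp add: a_def mangoldt_nonneg)
    have y0: "y > 0" using y pi_gt_zero by linarith
    note s = summable_fejer_mass[OF T y0, folded a_def] summable_fejer_mass[OF zero_less_one y0, folded a_def]
      summable_fejer_mass[OF zero_less_one, of "y - pi", folded a_def]
    have 1: "(\<lambda>n. if n \<in> W y then a n * T else 0) sums (\<Sum>n\<in>W y. a n * T)"
      by (rule sums_If_finite_set[OF fin])
    have 2: "(\<lambda>n. C / T * (a n * fejer 1 (ln (real n) - y) + a n * fejer 1 (ln (real n) - (y - pi)))) sums
       (C / T * (fejer_mass 1 y + fejer_mass 1 (y - pi)))"
      unfolding fejer_mass_def a_def[symmetric] using y s by (intro sums_mult sums_add summable_sums) auto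
    have "fejer_mass T y \<le> (\<Sum>n\<in>W y. a n * T) + C / T * (fejer_mass 1 y + fejer_mass 1 (y - pi))"
      unfolding fejer_mass_def[of T] a_def[symmetric]
    proof (rule sums_le[OF _ summable_sums[OF s(1)] sums_add[OF 1 2]])
      fix n
      show "a n * fejer T (ln (real n) - y) \<le> (if n \<in> W y then a n * T else 0) +
         C / T * (a n * fejer 1 (ln (real n) - y) + a n * fejer 1 (ln (real n) - (y - pi)))"
      proof (cases "n \<in> W y")
        case True
        have "0 \<le> C / T * (a n * fejer 1 (ln (real n) - y) + a n * fejer 1 (ln (real n) - (y - pi)))"
          using C1 T a by (intro mult_nonneg_nonneg add_nonneg_nonneg fejer_nonneg divide_nonneg_pos) auto
        moreover have "a n * fejer T (ln (real n) - y) \<le> a n * T"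
          by (intro mult_left_mono fejer_le T a)
        ultimately show ?thesis using True by simp
      next
        case False
        show ?thesis
        proof (cases "n = 0")
          case True then show ?thesis by (simp add: a_def)
        next
          case n: False
          then have "\<bar>ln (real n) - y\<bar> > d" using False by (auto simp: W_def)
          from mult_left_mono[OF fejer_le_shifted_sum[OF T d this] a[of n]]
          have "a n * fejer T (ln (real n) - y) \<le> a n * (C / T * (fejer 1 (ln (real n) - y) + fejer 1 (ln (real n) - y + pi)))"
            by (simp only: C_def)
          also have "ln (real n) - y + pi = ln (real n) - (y - pi)" by simp
          finally show ?thesis using False by (simp add: distrib_left mult_ac)
        qed
      qed
    qed
    then show ?thesis by (simp add: a_def sum_distrib_right)
  qed
  have shift: "((\<lambda>y. fejer_mass 1 (y - pi)) \<longlongrightarrow> 2 * pi) at_top"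
    by (rule filterlim_compose[OF tendsto_fejer_mass]) (simp, real_asymp)
  have "((\<lambda>y. fejer_mass T y - C / T * (fejer_mass 1 y + fejer_mass 1 (y - pi))) \<longlongrightarrow> 2 * pi - C / T * (2 * pi + 2 * pi)) at_top"
    by (intro tendsto_intros tendsto_fejer_mass shift T zero_less_one)
  moreover have "2 * pi - C / T * (2 * pi + 2 * pi) = pi" using C1 by (simp add: T_def)
  ultimately have "\<forall>\<^sub>F y in at_top. 1 < fejer_mass T y - C / T * (fejer_mass 1 y + fejer_mass 1 (y - pi))"
    using pi_gt3 by (intro order_tendstoD(1)) auto
  then have ev1: "\<forall>\<^sub>F y in at_top. 1 / T < (\<Sum>n\<in>W y. mangoldt n / real n)"
    using eventually_gt_at_top[of pi]
  proof eventually_elim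
    case (elim y)
    then have "1 < (\<Sum>n\<in>W y. mangoldt n / real n) * T" using main[of y] by linarith
    then show ?case using T by (simp add: divide_less_eq)
  qed
  \<comment> \<open>A bound for the proper prime powers: up to constants there are at most y
    exp(y/2) of them, each of weight at most y exp(-y).\<close>
  have "((\<lambda>y. (sqrt (exp (y + d)) + 1) * (log 2 (exp (y + d)) + 1) * ((y + d) / exp (y - d))) \<longlongrightarrow> 0) at_top"
    by real_asymp
  then have "\<forall>\<^sub>F y in at_top. (sqrt (exp (y + d)) + 1) * (log 2 (exp (y + d)) + 1) * ((y + d) / exp (y - d)) < 1 / T"
    using T by (intro order_tendstoD(2)) auto
  then show ?thesis using ev1 eventually_gt_at_top[of 0]
  proof eventually_elim
    case (elim y)
    show ?case
    proof (rule ccontr)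
      assume no: "\<nexists>p. prime p \<and> \<bar>ln (real p) - y\<bar> \<le> d"
      define P where "P = {n. primepow n \<and> \<not> prime n \<and> real n \<le> exp (y + d)}"
      have "(\<Sum>n\<in>W y. mangoldt n / real n) = (\<Sum>n\<in>W y \<inter> P. mangoldt n / real n :: real)"
        using no W_mem by (intro sum.mono_neutral_right fin) (auto simp: P_def W_def mangoldt_def)
      also have "\<dots> \<le> real (card (W y \<inter> P)) * ((y + d) / exp (y - d))"
      proof (rule sum_bounded_above)
        fix n assume n: "n \<in> W y \<inter> P"
        then have "n > 0" "ln (real n) \<le> y + d" by (auto simp: W_def)
        then have "mangoldt n \<le> y + d" using mangoldt_le_ln[of n] by linarith
        then show "mangoldt n / real n \<le> (y + d) / exp (y - d)"
          using n W_mem[of n y] elim d by (intro frac_le) auto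
      qed
      also have "\<dots> \<le> real (card P) * ((y + d) / exp (y - d))"
      proof (intro mult_right_mono)
        have "P \<subseteq> {..nat \<lfloor>exp (y + d)\<rfloor>}" by (auto simp: P_def le_nat_floor)
        then show "real (card (W y \<inter> P)) \<le> real (card P)"
          by (intro of_nat_mono card_mono) (auto intro: finite_subset)
      qed (use elim d in auto)
      also have "\<dots> \<le> (sqrt (exp (y + d)) + 1) * (log 2 (exp (y + d)) + 1) * ((y + d) / exp (y - d))"
        unfolding P_def using elim d
        by (intro mult_right_mono card_proper_prime_powers_le) auto
      finally show False using elim by linarith
    qed
  qed
qed

theorem eventually_prime_in_short_interval:
  fixes c :: real
  assumes c: "c > 1"
  shows "\<forall>\<^sub>F n in sequentially. \<exists>p. prime p \<and> n < p \<and> real p \<le> c * real n"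
proof -
  \<comment> \<open>The window of radius \<open>d\<close> around ln n + 2d lies strictly between ln
    n and ln n + 4d = ln (c n).\<close>
  define d where "d = ln c / 4"
  have d: "d > 0" using c by (simp add: d_def)
  have "filterlim (\<lambda>n. ln (real n) + 2 * d) at_top sequentially" by real_asymp
  from eventually_compose_filterlim[OF eventually_prime_near_exp[OF d] this]
  show ?thesis using eventually_gt_at_top[of 0]
  proof eventually_elim
    case (elim n)
    then obtain p where p: "prime p" "\<bar>ln (real p) - (ln (real n) + 2 * d)\<bar> \<le> d" by blast
    have p0: "real p > 0" using prime_gt_0_nat[OF p(1)] by simp
    have "ln (real n) < ln (real p)" using p(2) d by linarith
    then have "n < p" using p0 elim by simp
    moreover have "ln (real p) \<le> ln (c * real n)"
    proof -
      have "ln (c * real n) = ln c + ln (real n)" using c elim by (intro ln_mult_pos) auto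
      then show ?thesis using p(2) c unfolding d_def by linarith
    qed
    then have "real p \<le> c * real n" using p0 c elim by (subst (asm) ln_le_cancel_iff) auto
    ultimately show ?case using p(1) by blast
  qed
qed

section \<open>Clique-free sets from colourings\<close>

text \<open>Downward induction on the size: discarding an element of smallest value does not lower
  the average.\<close>

lemma exists_subset_sum_ge_average:
  fixes f :: "'a \<Rightarrow> real"
  assumes "finite C" "k \<le> card C"
  shows "\<exists>D\<subseteq>C. card D = k \<and> real k * sum f C \<le> real (card C) * sum f D"
  using assms(2)
proof (induction rule: inc_induct)
  case base
  show ?case by (rule exI[of _ C]) simp
next
  case (step n)
  then obtain D where D: "D \<subseteq> C" "card D = Suc n" "real (Suc n) * sum f C \<le> real (card C) * sum f D" by blast
  have fin: "finite D" "D \<noteq> {}" using D assms(1) finite_subset by auto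
  obtain x where x: "x \<in> D" "\<forall>y\<in>D. f x \<le> f y"
    using arg_min_if_finite(1)[OF fin, of f] arg_min_least[OF fin, of _ f] by blast
  have m: "real (Suc n) * f x \<le> sum f D"
    using sum_bounded_below[of D "f x" f] x(2) D(2) by simp
  have sD: "sum f (D - {x}) = sum f D - f x" using fin(1) x(1) by (simp add: sum_diff1)
  have "real (Suc n) * (real n * sum f C) \<le> real n * (real (card C) * sum f D)"
    using mult_left_mono[OF D(3), of "real n"] by (simp add: mult_ac)
  also have "\<dots> \<le> real (Suc n) * (real (card C) * (sum f D - f x))"
    using mult_left_mono[OF m, of "real (card C)"] by (simp add: algebra_simps)
  finally have "real n * sum f C \<le> real (card C) * sum f (D - {x})"
    unfolding sD by (rule mult_left_le_imp_le) simp
  then show ?case using D(1,2) x(1) fin(1) by (intro exI[of _ "D - {x}"]) auto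
qed

text \<open>A clique on s vertices inside the union of s - 1 colour classes would, by pigeonhole,
  contain two adjacent vertices of one colour. The s - 1 largest classes have at least average
  size.\<close>

lemma clique_free_number_ge_coloring:
  fixes c :: "(nat \<Rightarrow> nat) \<Rightarrow> 'c"
  assumes s: "s \<ge> 1" and fin: "finite C" and card: "s - 1 \<le> card C" "C \<noteq> {}"
    and c: "\<And>x. x \<in> binary_cube n \<Longrightarrow> c x \<in> C"
    and proper: "\<And>x y. x \<in> binary_cube n \<Longrightarrow> y \<in> binary_cube n \<Longrightarrow> hamming_dist n x y = r \<Longrightarrow> c x \<noteq> c y"
  shows "real (\<alpha>\<^bsub>s\<^esub> (with_proj (hamming_graph r n))) \<ge> (real s - 1) / real (card C) * 2 ^ n"
proof -
  define f where "f a = real (card {x \<in> binary_cube n. c x = a})" for a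
  let ?G = "with_proj (hamming_graph r n)"
  have card_f: "real (card {x \<in> binary_cube n. c x \<in> D}) = sum f D" if "D \<subseteq> C" for D
  proof -
    have "{x \<in> binary_cube n. c x \<in> D} = (\<Union>a\<in>D. {x \<in> binary_cube n. c x = a})" by auto
    moreover have "card \<dots> = (\<Sum>a\<in>D. card {x \<in> binary_cube n. c x = a})"
      using that fin finite_binary_cube[of n] by (intro card_UN_disjoint) (auto intro: finite_subset)
    ultimately show ?thesis by (simp add: f_def)
  qed
  have "{x \<in> binary_cube n. c x \<in> C} = binary_cube n" using c by auto
  then have sum_C: "sum f C = 2 ^ n" using card_f[of C] by (simp add: card_binary_cube)
  obtain D where D: "D \<subseteq> C" "card D = s - 1" "real (s - 1) * sum f C \<le> real (card C) * sum f D"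
    using exists_subset_sum_ge_average[OF fin card(1)] by blast
  define S where "S = {x \<in> binary_cube n. c x \<in> D}"
  have "\<not> contains_clique s (?G \<restriction> S)"
  proof
    assume "contains_clique s (?G \<restriction> S)"
    then obtain H where H: "subgraph H (?G \<restriction> S)" "complete_digraph s H"
      by (auto simp: contains_clique_def)
    have card_H: "card (verts H) = s" and E: "arcs_ends H = {(u, v). (u, v) \<in> verts H \<times> verts H \<and> u \<noteq> v}"
      using H(2) by (auto simp: complete_digraph_def)
    have sub: "verts H \<subseteq> S" using H(1) by (auto simp: subgraph_def)
    then have "c ` verts H \<subseteq> D" by (auto simp: S_def)
    moreover have "finite D" using D(1) fin finite_subset by blast
    ultimately have "card (c ` verts H) < card (verts H)"
      using card_mono[of D "c ` verts H"] D(2) card_H s by linarith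
    then have "\<not> inj_on c (verts H)" using pigeonhole by blast
    then obtain u v where uv: "u \<in> verts H" "v \<in> verts H" "u \<noteq> v" "c u = c v" by (auto simp: inj_on_def)
    then have "(u, v) \<in> arcs_ends H" using E by auto
    then have "(u, v) \<in> parcs (hamming_graph r n)"
      using H(1) by (auto simp: subgraph_def compatible_def arcs_ends_def arc_to_ends_def)
    then show False using proper[of u v] uv(4) by (auto simp: hamming_graph_def)
  qed
  moreover have "S \<subseteq> verts ?G" by (auto simp: S_def hamming_graph_def)
  moreover have "finite (verts ?G)" by (simp add: hamming_graph_def finite_binary_cube)
  ultimately have "card S \<le> \<alpha>\<^bsub>s\<^esub> ?G" using clique_free_number_attained(2) s by blast
  moreover have "(real s - 1) / real (card C) * 2 ^ n \<le> real (card S)"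
  proof -
    have "card C > 0" using card(2) fin by auto
    moreover have "(real s - 1) * 2 ^ n \<le> real (card C) * real (card S)"
      using D(3) s card_f[OF D(1)] sum_C by (simp add: S_def of_nat_diff)
    ultimately show ?thesis by (simp add: field_simps)
  qed
  ultimately show ?thesis by (meson of_nat_le_iff order_trans)
qed

section \<open>Words as subsets of the coordinates\<close>

definition cube_supp :: "nat \<Rightarrow> (nat \<Rightarrow> nat) \<Rightarrow> nat set" where
  "cube_supp n x = {i \<in> {..<n}. x i = 1}"

lemma cube_supp_subset: "cube_supp n x \<subseteq> {..<n}"
  by (auto simp: cube_supp_def)

lemma finite_cube_supp: "finite (cube_supp n x)"
  using cube_supp_subset finite_subset by blast

lemma hamming_dist_cube_supp:
  assumes "x \<in> binary_cube n" "y \<in> binary_cube n"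
  shows "hamming_dist n x y = card (cube_supp n x - cube_supp n y) + card (cube_supp n y - cube_supp n x)"
proof -
  have "x i = 0 \<or> x i = 1" "y i = 0 \<or> y i = 1" if "i < n" for i
    using assms that by (auto simp: binary_cube_def PiE_def Pi_def)
  then have "{i \<in> {..<n}. x i \<noteq> y i} = (cube_supp n x - cube_supp n y) \<union> (cube_supp n y - cube_supp n x)"
    by (fastforce simp: cube_supp_def)
  then show ?thesis unfolding hamming_dist_def
    using finite_cube_supp by (simp, subst card_Un_disjoint) auto
qed

section \<open>Colouring by symmetric functions modulo a prime\<close>

text \<open>A locator polynomial: its coefficients are the elementary symmetric functions of the
  labels i + 1. The shift by one keeps the labels nonzero modulo a prime p > n.\<close>

definition loc_poly :: "nat set \<Rightarrow> int poly" where
  "loc_poly U = prod (\<lambda>i. [:1, int (Suc i):]) U"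

lemma coeff_0_loc_poly: "coeff (loc_poly U) 0 = 1"
  by (simp add: loc_poly_def poly_0_coeff_0[symmetric] poly_prod)

lemma degree_loc_poly_le: "finite U \<Longrightarrow> degree (loc_poly U) \<le> card U"
  unfolding loc_poly_def using degree_prod_sum_le[of U "\<lambda>i. [:1, int (Suc i):]"] by simp

text \<open>The factor belonging to U \<inter> V has constant coefficient 1 and can be cancelled up
  to degree t. The cofactors have degree at most t, hence agree modulo p, and comparing a root of
  one with the roots of the other gives a common label of two disjoint sets.\<close>

lemma loc_poly_coeff_cong:
  assumes p: "prime p" "n < p" and U: "U \<subseteq> {..<n}" and V: "V \<subseteq> {..<n}"
    and t: "t \<ge> 1" "card (U - V) = t" "card (V - U) = t"
    and cong: "\<And>j. j \<in> {1..t} \<Longrightarrow> [coeff (loc_poly U) j = coeff (loc_poly V) j] (mod int p)"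
  shows False
proof -
  define d where "d = loc_poly (U - V) - loc_poly (V - U)"
  define q where "q = loc_poly (U \<inter> V)"
  have fin: "finite U" "finite V" using U V finite_subset by auto
  have UV: "loc_poly U = loc_poly (U - V) * q" "loc_poly V = loc_poly (V - U) * q"
  proof -
    have "Z = (Z - Z') \<union> (Z \<inter> Z')" for Z Z' :: "nat set" by auto
    then have "loc_poly Z = loc_poly (Z - Z') * loc_poly (Z \<inter> Z')" if "finite Z" for Z Z'
      unfolding loc_poly_def using that by (subst prod.union_disjoint[symmetric]) (auto intro: prod.cong)
    from this[OF fin(1), of V] this[OF fin(2), of U]
    show "loc_poly U = loc_poly (U - V) * q" "loc_poly V = loc_poly (V - U) * q"
      by (simp_all only: q_def Int_commute)
  qed
  have dq: "loc_poly U - loc_poly V = d * q" unfolding UV d_def by (simp add: left_diff_distrib)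
  have dvd_dq: "int p dvd coeff (d * q) j" if "j \<le> t" for j
  proof (cases "j = 0")
    case True
    then show ?thesis by (simp add: dq[symmetric] coeff_0_loc_poly)
  next
    case False
    then show ?thesis using cong[of j] that unfolding dq[symmetric]
      by (simp add: cong_iff_dvd_diff)
  qed
  \<comment> \<open>The system is triangular with unit diagonal, as the constant coefficient of
    \<open>q\<close> is 1.\<close>
  have dvd_d: "int p dvd coeff d j" if "j \<le> t" for j
    using that
  proof (induction j rule: less_induct)
    case (less j)
    have "coeff (d * q) j = (\<Sum>i\<le>j. coeff d i * coeff q (j - i))" by (rule coeff_mult)
    also have "\<dots> = (\<Sum>i<j. coeff d i * coeff q (j - i)) + coeff d j"
      by (simp add: lessThan_Suc_atMost[symmetric] q_def coeff_0_loc_poly)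
    finally have "coeff d j = coeff (d * q) j - (\<Sum>i<j. coeff d i * coeff q (j - i))" by simp
    moreover have "int p dvd (\<Sum>i<j. coeff d i * coeff q (j - i))"
      using less by (intro dvd_sum dvd_mult2) auto
    ultimately show ?case using dvd_dq[OF less.prems] by simp
  qed
  \<comment> \<open>Both differences having exactly t elements is essential here: no coefficient
    beyond the controlled range survives.\<close>
  have "degree d \<le> t" unfolding d_def
    using degree_loc_poly_le[of "U - V"] degree_loc_poly_le[of "V - U"] fin t by (intro degree_diff_le) auto
  then have dvd_all: "int p dvd coeff d j" for j
    using dvd_d[of j] coeff_eq_0[of d j] by (cases "j \<le> t") auto
  have dvd_poly: "int p dvd poly d u" for u
    unfolding poly_altdef by (intro dvd_sum dvd_mult2 dvd_all)
  \<comment> \<open>At \<open>u = -1 / (a + 1)\<close> modulo \<open>p\<close> one side vanishes, hence so does a factor of the other.\<close>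
  obtain a where a: "a \<in> U - V" using t by (metis card.empty ex_in_conv not_one_le_zero)
  have an: "Suc a < p" using a U p(2) by auto
  then have "coprime (int (Suc a)) (int p)"
    using p(1) by (metis coprime_commute coprime_int_iff dvd_imp_le not_less prime_imp_coprime zero_less_Suc)
  then obtain v where v: "[int (Suc a) * v = 1] (mod int p)" using cong_solve_coprime_int by blast
  define u where "u = - v"
  have ua: "int p dvd 1 + int (Suc a) * u" using v unfolding u_def
    by (metis cong_iff_dvd_diff cong_sym mult_minus_right diff_conv_add_uminus)
  have "poly (loc_poly Z) u = prod (\<lambda>i. 1 + int (Suc i) * u) Z" for Z
    by (simp add: loc_poly_def poly_prod mult.commute)
  note pol = this
  have "int p dvd poly (loc_poly (U - V)) u"
    unfolding pol using fin a ua by (meson dvd_prodI dvd_trans finite_Diff)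
  then have "int p dvd poly (loc_poly (V - U)) u" using dvd_poly[of u] unfolding d_def
    by (metis dvd_diff_commute dvd_diff_right_iff poly_diff)
  then obtain b where b: "b \<in> V - U" "int p dvd 1 + int (Suc b) * u"
    unfolding pol using prime_dvd_prod_iff[of "V - U" "int p"] p(1) fin by auto
  have bn: "Suc b < p" using b V p(2) by auto
  have "int p dvd (1 + int (Suc b) * u) - (1 + int (Suc a) * u)" using b(2) ua by (rule dvd_diff)
  also have "\<dots> = (int b - int a) * u" by (simp add: algebra_simps)
  finally have "int p dvd int b - int a \<or> int p dvd u" using p(1) by (simp add: prime_dvd_mult_iff)
  \<comment> \<open>\<open>u\<close> is a unit modulo p, because (a + 1) u is congruent to
    -1.\<close>
  moreover have "\<not> int p dvd u"
  proof
    assume "int p dvd u"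
    then have "int p dvd 1" using ua by (metis dvd_add_left_iff dvd_mult)
    then show False using p(1) by auto
  qed
  ultimately have "int p dvd int b - int a" by blast
  \<comment> \<open>Both labels lie strictly between 0 and p, so congruent labels are equal.\<close>
  then have "int b = int a"
    using dvd_imp_le_int[of "int b - int a" "int p"] an bn by (cases "int b = int a") auto
  then show False using a b by auto
qed

lemma clique_free_number_ge_prime:
  assumes p: "prime p" "n < p" and s: "s \<ge> 1" "s - 1 \<le> p" and t: "t \<ge> 1"
  shows "real (\<alpha>\<^bsub>s\<^esub> (with_proj (hamming_graph (2 * t) n))) \<ge> (real s - 1) / ((real t + 1) * real p ^ t) * 2 ^ n"
proof -
  define C where "C = {..<Suc t} \<times> ({1..t} \<rightarrow>\<^sub>E {0..<int p})"
  define c where "c x = ((card (cube_supp n x) div 2) mod Suc t,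
     (\<lambda>j\<in>{1..t}. coeff (loc_poly (cube_supp n x)) j mod int p))" for x
  have p0: "p > 0" using p by auto
  have card_C: "card C = Suc t * p ^ t" by (simp add: C_def card_cartesian_product card_PiE)
  have fin: "finite C" by (simp add: C_def finite_PiE)
  have "p \<le> p ^ t" using t p0 by (simp add: self_le_power)
  also have "\<dots> \<le> card C" by (simp add: card_C)
  finally have le: "s - 1 \<le> card C" using s by simp
  have ne: "C \<noteq> {}" using card_C p0 by auto
  have c_mem: "c x \<in> C" for x using p0 by (auto simp: c_def C_def)
  have proper: "c x \<noteq> c y" if xy: "x \<in> binary_cube n" "y \<in> binary_cube n" "hamming_dist n x y = 2 * t" for x y
  proof
    assume eq: "c x = c y"
    define U where "U = cube_supp n x"
    define V where "V = cube_supp n y"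
    define a where "a = card (U - V)"
    define b where "b = card (V - U)"
    define z where "z = card (U \<inter> V)"
    have fin: "finite U" "finite V" by (simp_all add: U_def V_def finite_cube_supp)
    have ab: "a + b = 2 * t" using xy hamming_dist_cube_supp[OF xy(1,2)] by (simp add: a_def b_def U_def V_def)
    have UV: "card U = z + a" "card V = z + b"
      using card_Int_Diff[OF fin(1), of V] card_Int_Diff[OF fin(2), of U]
      by (simp_all add: z_def a_def b_def Int_commute)
    have m: "((z + a) div 2) mod Suc t = ((z + b) div 2) mod Suc t"
      using eq by (simp add: c_def U_def[symmetric] V_def[symmetric] UV)
    \<comment> \<open>Since a + b = 2t, the weights differ by an even number 2e with e \<le> t, so
      the half weights differ by e. Equality modulo t + 1 then leaves only e = 0.\<close>
    have key: "d = 0" if "b' + d = t" "(z' + d) mod Suc t = z' mod Suc t" for b' d z' :: nat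
    proof -
      have "[z' + d = z' + 0] (mod Suc t)" using that(2) by (simp add: cong_def)
      then have "[d = 0] (mod Suc t)" by (simp only: cong_add_lcancel_nat)
      then have "Suc t dvd d" by (simp add: cong_0_iff)
      moreover have "d < Suc t" using that(1) by simp
      ultimately show ?thesis using dvd_imp_le[of "Suc t" d] by linarith
    qed
    have "a = b"
    proof (cases "b \<le> a")
      case True
      define e where "e = t - b"
      have e: "a = b + 2 * e" "b + e = t" using ab True by (auto simp: e_def)
      then have "(z + a) div 2 = (z + b) div 2 + e" by simp
      then have "e = 0" using key[OF e(2), of "(z + b) div 2"] m by simp
      then show ?thesis using e by simp
    next
      case False
      define e where "e = t - a"
      have e: "b = a + 2 * e" "a + e = t" using ab False by (auto simp: e_def)
      then have "(z + b) div 2 = (z + a) div 2 + e" by simp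
      then have "e = 0" using key[OF e(2), of "(z + a) div 2"] m by simp
      then show ?thesis using e by simp
    qed
    then have t': "card (U - V) = t" "card (V - U) = t" using ab by (auto simp: a_def b_def)
    have "coeff (loc_poly U) j mod int p = coeff (loc_poly V) j mod int p" if "j \<in> {1..t}" for j
      using fun_cong[OF arg_cong[OF eq, of snd], of j] that by (simp add: c_def U_def V_def)
    then have cong: "[coeff (loc_poly U) j = coeff (loc_poly V) j] (mod int p)" if "j \<in> {1..t}" for j
      using that by (simp add: cong_def)
    have "U \<subseteq> {..<n}" "V \<subseteq> {..<n}" by (simp_all add: U_def V_def cube_supp_subset)
    from loc_poly_coeff_cong[OF p this t t' cong] show False .
  qed
  have "(real s - 1) / real (card C) * 2 ^ n \<le> real (\<alpha>\<^bsub>s\<^esub> (with_proj (hamming_graph (2 * t) n)))"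
    by (rule clique_free_number_ge_coloring[OF s(1) fin le ne c_mem proper])
  moreover have "real (card C) = (real t + 1) * real p ^ t" by (simp add: card_C algebra_simps)
  ultimately show ?thesis by (simp only:)
qed

section \<open>Colouring by BCH syndromes\<close>

lemma two_eq_0_bit_closure: "x + x = (0 :: bit alg_closure)"
proof -
  have "(2 :: bit alg_closure) = to_ac 2" by (rule to_ac_numeral[symmetric])
  also have "(2 :: bit) = 0" by simp
  finally have "(2 :: bit alg_closure) = 0" by simp
  then show ?thesis by (simp flip: mult_2)
qed

lemma power2_add_bit_closure: "(x + y)\<^sup>2 = x\<^sup>2 + (y :: bit alg_closure)\<^sup>2"
proof -
  have "(x + y)\<^sup>2 = x\<^sup>2 + y\<^sup>2 + (x * y + x * y)" by (simp add: power2_eq_square algebra_simps)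
  then show ?thesis by (simp only: two_eq_0_bit_closure add_0_right)
qed

lemma power2_sum_bit_closure: "(sum f A)\<^sup>2 = sum (\<lambda>i. (f i :: bit alg_closure)\<^sup>2) A"
  by (induction A rule: infinite_finite_induct) (auto simp: power2_add_bit_closure)

text \<open>The field with \<open>2 ^ m\<close> elements inside the algebraic closure of the field with two elements.\<close>

definition fixed_field :: "nat \<Rightarrow> bit alg_closure set" where
  "fixed_field m = {x. x ^ (2 ^ m) = x}"

lemma fixed_field_add: "x \<in> fixed_field m \<Longrightarrow> y \<in> fixed_field m \<Longrightarrow> x + y \<in> fixed_field m"
proof -
  have "(x + y) ^ (2 ^ m) = x ^ (2 ^ m) + y ^ (2 ^ m)"
  proof (induction m)
    case (Suc m)
    have "(x + y) ^ (2 ^ Suc m) = ((x + y) ^ (2 ^ m))\<^sup>2" by (simp add: power_mult[symmetric] mult.commute)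
    also have "\<dots> = (x ^ (2 ^ m))\<^sup>2 + (y ^ (2 ^ m))\<^sup>2" by (simp only: Suc power2_add_bit_closure)
    also have "\<dots> = x ^ (2 ^ Suc m) + y ^ (2 ^ Suc m)" by (simp add: power_mult[symmetric] mult.commute)
    finally show ?case .
  qed simp
  then show "x \<in> fixed_field m \<Longrightarrow> y \<in> fixed_field m \<Longrightarrow> x + y \<in> fixed_field m"
    by (simp add: fixed_field_def)
qed

lemma fixed_field_power: "x \<in> fixed_field m \<Longrightarrow> x ^ k \<in> fixed_field m"
proof -
  assume "x \<in> fixed_field m"
  then have "x ^ (2 ^ m) = x" by (simp add: fixed_field_def)
  then have "(x ^ k) ^ (2 ^ m) = x ^ k" by (metis power_mult mult.commute)
  then show ?thesis by (simp add: fixed_field_def)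
qed

lemma fixed_field_sum: "(\<And>i. i \<in> A \<Longrightarrow> f i \<in> fixed_field m) \<Longrightarrow> sum f A \<in> fixed_field m"
proof (induction A rule: infinite_finite_induct)
  case (insert a A)
  then show ?case by (simp add: fixed_field_add)
qed (simp_all add: fixed_field_def power_0_left)

text \<open>The polynomial X^q - X with q = 2^m splits over the algebraic closure, and its
  derivative is -1 in characteristic two, so its q roots are simple.\<close>

lemma card_fixed_field:
  assumes m: "m \<ge> 1"
  shows "card (fixed_field m) = 2 ^ m" "finite (fixed_field m)"
proof -
  define q where "q = (2::nat) ^ m"
  have q: "q > 1" unfolding q_def by (rule one_less_power) (use m in auto)
  define P :: "bit alg_closure poly" where "P = Polynomial.monom 1 q - Polynomial.monom 1 1"
  have "(of_nat q :: bit alg_closure) = 0"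
  proof -
    have "of_nat q = (2::bit alg_closure) ^ m" by (simp add: q_def)
    also have "(2::bit alg_closure) = 0" using two_eq_0_bit_closure[of 1] by simp
    finally show ?thesis using m by (simp add: power_0_left)
  qed
  then have pd: "pderiv P = - 1" by (simp add: P_def pderiv_diff pderiv_monom one_pCons monom_0)
  have deg: "Polynomial.degree P = q"
  proof -
    have "Polynomial.degree (- Polynomial.monom (1::bit alg_closure) 1) < Polynomial.degree (Polynomial.monom (1::bit alg_closure) q)"
      using q by (simp add: degree_monom_eq)
    from degree_add_eq_left[OF this] show ?thesis by (simp add: P_def degree_monom_eq)
  qed
  then have P0: "P \<noteq> 0" using q by auto
  obtain A where A: "size A = Polynomial.degree P"
    "P = Polynomial.smult (Polynomial.lead_coeff P) (prod_mset (image_mset (\<lambda>x. [:-x, 1:]) A))"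
    using alg_closed_imp_factorization[OF P0] by blast
  have roots: "poly P x = 0 \<longleftrightarrow> x \<in># A" for x
    by (subst A(2)) (use P0 in \<open>auto simp: poly_prod_mset prod_mset_zero_iff\<close>)
  have poly_P: "poly P x = x ^ q - x" for x by (simp add: P_def poly_monom)
  have ff: "fixed_field m = set_mset A"
    using roots poly_P by (auto simp: fixed_field_def q_def)
  have "count A x \<le> 1" for x
  proof (rule ccontr)
    assume "\<not> count A x \<le> 1"
    then have "{#x, x#} \<subseteq># A" by (auto simp: subseteq_mset_def)
    then obtain B where "A = {#x, x#} + B" unfolding mset_subset_eq_exists_conv by blast
    then have A': "A = add_mset x (add_mset x B)" by simp
    define R where "R = Polynomial.smult (Polynomial.lead_coeff P) (prod_mset (image_mset (\<lambda>x. [:-x, 1:]) B))"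
    have P_eq: "P = [:-x, 1:] * ([:-x, 1:] * R)"
      unfolding R_def
      by (rule trans[OF A(2)]) (simp only: A' image_mset_add_mset prod_mset.add_mset mult_smult_right)
    have "poly (pderiv P) x = 0" unfolding P_eq
      by (simp add: pderiv_mult del: mult_pCons_left mult_pCons_right)
    then show False by (simp add: pd)
  qed
  then have count: "count A x = 1" if "x \<in># A" for x
    using that by (simp add: le_antisym Suc_le_eq)
  have "size A = sum (count A) (set_mset A)" by (rule size_multiset_overloaded_eq)
  also have "\<dots> = sum (\<lambda>_. 1) (set_mset A)" by (rule sum.cong) (simp_all add: count)
  finally have "card (set_mset A) = size A" by simp
  then show "card (fixed_field m) = 2 ^ m" "finite (fixed_field m)"
    using A(1) deg by (simp_all add: ff q_def)
qed

text \<open>In characteristic two the power sum of exponent 2j is the square of that of exponent j,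
  so all power sums of exponents 1 to 2t vanish. Hence any polynomial of degree at most 2t without
  constant term sums to 0 over the labels, which fails for a suitable product.\<close>

lemma char_two_power_sums_nonzero:
  fixes a :: "nat \<Rightarrow> bit alg_closure"
  assumes E: "finite E" "inj_on a E" "0 \<notin> a ` E" and card: "card E = 2 * t" "t \<ge> 1"
    and odd: "\<And>j. j < t \<Longrightarrow> sum (\<lambda>i. a i ^ (2 * j + 1)) E = 0"
  shows False
proof -
  have ps: "sum (\<lambda>i. a i ^ k) E = 0" if "k \<ge> 1" "k \<le> 2 * t" for k
    using that
  proof (induction k rule: less_induct)
    case (less k)
    show ?case
    proof (cases "even k")
      case True
      then obtain j where j: "k = 2 * j" by auto
      then have "sum (\<lambda>i. a i ^ j) E = 0" using less by auto
      moreover have "sum (\<lambda>i. a i ^ k) E = (sum (\<lambda>i. a i ^ j) E)\<^sup>2"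
        unfolding power2_sum_bit_closure j by (simp add: power_mult[symmetric] mult.commute)
      ultimately show ?thesis by simp
    next
      case False
      then obtain j where j: "k = 2 * j + 1" by (auto elim: oddE)
      then show ?thesis using odd[of j] less.prems by simp
    qed
  qed
  have "E \<noteq> {}" using card by auto
  then obtain e where e: "e \<in> E" by blast
  \<comment> \<open>\<open>Q\<close> has degree \<open>2t\<close>, no constant term, and vanishes on all labels but one.\<close>
  define Q where "Q = [:0, 1:] * prod (\<lambda>i. [:- a i, 1:]) (E - {e})"
  have "Polynomial.degree (prod (\<lambda>i. [:- a i, 1:]) (E - {e})) \<le> card (E - {e})"
    using degree_prod_sum_le[of "E - {e}" "\<lambda>i. [:- a i, 1:]"] E(1) by simp
  then have deg: "Polynomial.degree Q \<le> 2 * t"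
    using degree_mult_le[of "[:0, 1:]" "prod (\<lambda>i. [:- a i, 1:]) (E - {e})"] e E(1) card
    by (simp add: Q_def card_Diff_singleton_if)
  have Q0: "Polynomial.coeff Q 0 = 0" by (simp add: Q_def poly_0_coeff_0[symmetric])
  have "sum (\<lambda>i. poly Q (a i)) E = sum (\<lambda>i. sum (\<lambda>k. Polynomial.coeff Q k * a i ^ k) {..Polynomial.degree Q}) E"
    by (simp add: poly_altdef)
  also have "\<dots> = sum (\<lambda>k. Polynomial.coeff Q k * sum (\<lambda>i. a i ^ k) E) {..Polynomial.degree Q}"
    by (subst sum.swap) (simp add: sum_distrib_left)
  also have "\<dots> = 0"
  proof (rule sum.neutral, rule ballI)
    fix k assume "k \<in> {..Polynomial.degree Q}"
    then show "Polynomial.coeff Q k * sum (\<lambda>i. a i ^ k) E = 0"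
      using Q0 ps[of k] deg by (cases "k = 0") auto
  qed
  also have "sum (\<lambda>i. poly Q (a i)) E = poly Q (a e) + sum (\<lambda>i. poly Q (a i)) (E - {e})"
    by (rule sum.remove[OF E(1) e])
  also have "sum (\<lambda>i. poly Q (a i)) (E - {e}) = 0"
    using E(1) by (intro sum.neutral) (auto simp: Q_def poly_prod)
  finally have "poly Q (a e) = 0" by simp
  then have "a e = 0 \<or> prod (\<lambda>i. a e - a i) (E - {e}) = 0" by (simp add: Q_def poly_prod)
  moreover have "a e \<noteq> 0" using E(3) e by force
  moreover have "prod (\<lambda>i. a e - a i) (E - {e}) \<noteq> 0"
    using E(1) inj_on_eq_iff[OF E(2) e] by (subst prod_zero_iff) auto
  ultimately show False by blast
qed

lemma clique_free_number_ge_char_two: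
  assumes n: "n < 2 ^ m" and m: "m \<ge> 1" and s: "s \<ge> 1" "s - 1 \<le> 2 ^ m" and t: "t \<ge> 1"
  shows "real (\<alpha>\<^bsub>s\<^esub> (with_proj (hamming_graph (2 * t) n))) \<ge> (real s - 1) / (2 ^ m) ^ t * 2 ^ n"
proof -
  note F = card_fixed_field[OF m]
  have "0 \<in> fixed_field m" by (simp add: fixed_field_def power_0_left)
  then have "card (fixed_field m - {0}) = 2 ^ m - 1" using F by simp
  \<comment> \<open>\<open>n < 2 ^ m\<close> leaves room for n distinct nonzero labels.\<close>
  then have "card {..<n} \<le> card (fixed_field m - {0})" using n by simp
  then obtain a where a: "inj_on a {..<n}" "a ` {..<n} \<subseteq> fixed_field m - {0}"
    using card_le_inj[of "{..<n}" "fixed_field m - {0}"] F(2) by auto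
  define C where "C = ({..<t} \<rightarrow>\<^sub>E fixed_field m)"
  define c where "c x = (\<lambda>j\<in>{..<t}. sum (\<lambda>i. a i ^ (2 * j + 1)) (cube_supp n x))" for x
  have card_C: "card C = (2 ^ m) ^ t" by (simp add: C_def card_PiE F(1))
  have fin: "finite C" using F(2) by (simp add: C_def finite_PiE)
  have "(2::nat) ^ m \<le> (2 ^ m) ^ t" using t by (simp add: self_le_power)
  then have le: "s - 1 \<le> card C" using s card_C by linarith
  have ne: "C \<noteq> {}" using card_C by auto
  have c_mem: "c x \<in> C" for x
    unfolding c_def C_def using a(2) cube_supp_subset[of n x]
    by (auto intro!: fixed_field_sum fixed_field_power simp del: power_Suc)
  have proper: "c x \<noteq> c y" if xy: "x \<in> binary_cube n" "y \<in> binary_cube n" "hamming_dist n x y = 2 * t" for x y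
  proof
    assume eq: "c x = c y"
    define U where "U = cube_supp n x"
    define V where "V = cube_supp n y"
    have UV: "finite U" "finite V" "U \<subseteq> {..<n}" "V \<subseteq> {..<n}"
      by (simp_all add: U_def V_def finite_cube_supp cube_supp_subset)
    define E where "E = (U - V) \<union> (V - U)"
    have E: "finite E" "E \<subseteq> {..<n}" using UV by (auto simp: E_def)
    have card: "card E = 2 * t"
      using hamming_dist_cube_supp[OF xy(1,2)] xy(3) UV(1,2) unfolding E_def U_def[symmetric] V_def[symmetric]
      by (subst card_Un_disjoint) auto
    have "sum (\<lambda>i. a i ^ (2 * j + 1)) E = 0" if j: "j < t" for j
    proof -
      define f where "f i = a i ^ (2 * j + 1)" for i
      have split: "sum f Z = sum f (Z \<inter> Z') + sum f (Z - Z')" if "finite Z" for Z Z' :: "nat set"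
        using that by (rule sum.Int_Diff)
      have "sum f U = sum f V"
        using fun_cong[OF eq, of j] j by (simp add: c_def U_def V_def f_def)
      \<comment> \<open>Common coordinates cancel. The two equal sums over the differences then add
        up to 0 in characteristic two, so the odd power sums over the symmetric difference
        vanish.\<close>
      then have "sum f (U - V) = sum f (V - U)"
        using split[OF UV(1), of V] split[OF UV(2), of U] by (simp add: Int_commute)
      moreover have "sum f E = sum f (U - V) + sum f (V - U)"
        unfolding E_def using UV by (intro sum.union_disjoint) auto
      ultimately show ?thesis using two_eq_0_bit_closure by (simp add: f_def)
    qed
    moreover have "inj_on a E" using a(1) E(2) inj_on_subset by blast
    moreover have "0 \<notin> a ` E" using a(2) E(2) by auto
    ultimately show False using char_two_power_sums_nonzero[OF E(1) _ _ card t] by blast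
  qed
  have "(real s - 1) / real (card C) * 2 ^ n \<le> real (\<alpha>\<^bsub>s\<^esub> (with_proj (hamming_graph (2 * t) n)))"
    by (rule clique_free_number_ge_coloring[OF s(1) fin le ne c_mem proper])
  then show ?thesis by (simp add: card_C)
qed

section \<open>Asymptotic lower bounds\<close>

lemma exists_smallo_lower_bound:
  fixes A :: "nat \<Rightarrow> real" and N :: "nat \<Rightarrow> nat"
  assumes pos: "\<forall>\<^sub>F m in sequentially. N m > 0"
    and bound: "\<And>d. d > 0 \<Longrightarrow> \<forall>\<^sub>F m in sequentially. c - d \<le> A m * real (N m) ^ t / 2 ^ N m"
  shows "\<exists>\<epsilon> :: nat \<Rightarrow> real. \<epsilon> \<in> o(\<lambda>_. 1) \<and>
     (\<forall>\<^sub>F m in sequentially. A m \<ge> (c + \<epsilon> m) * (2 ^ N m / real (N m) ^ t))"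
proof (intro exI conjI)
  \<comment> \<open>Clipped at 0: only a lower bound on the ratio is available, so any excess above
    \<open>c\<close> is discarded to make \<open>e\<close> tend to 0.\<close>
  define e where "e m = min 0 (A m * real (N m) ^ t / 2 ^ N m - c)" for m
  have "e \<longlonglongrightarrow> 0"
  proof (rule tendstoI)
    fix d :: real assume "d > 0"
    then have "\<forall>\<^sub>F m in sequentially. c - d / 2 \<le> A m * real (N m) ^ t / 2 ^ N m" by (intro bound) simp
    then show "\<forall>\<^sub>F m in sequentially. dist (e m) 0 < d"
      by eventually_elim (use \<open>d > 0\<close> in \<open>auto simp: e_def min_def\<close>)
  qed
  then show "e \<in> o(\<lambda>_. 1)" by (intro smalloI_tendsto) auto
  show "\<forall>\<^sub>F m in sequentially. A m \<ge> (c + e m) * (2 ^ N m / real (N m) ^ t)"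
    using pos
  proof eventually_elim
    case (elim m)
    have "(c + e m) * (2 ^ N m / real (N m) ^ t) \<le> (A m * real (N m) ^ t / 2 ^ N m) * (2 ^ N m / real (N m) ^ t)"
      by (intro mult_right_mono) (auto simp: e_def)
    also have "\<dots> = A m" using elim by simp
    finally show ?case .
  qed
qed

lemma clique_free_number_lower_general:
  fixes d :: real
  assumes s: "s \<ge> 2" and t: "t \<ge> 1" and d: "d > 0"
  shows "\<forall>\<^sub>F n in sequentially. (real s - 1) / (real t + 1) - d \<le>
     real (\<alpha>\<^bsub>s\<^esub> (with_proj (hamming_graph (2 * t) n))) * real n ^ t / 2 ^ n"
proof -
  define c where "c = (real s - 1) / (real t + 1)"
  have c: "c \<ge> 0" using s by (simp add: c_def)
  \<comment> \<open>By continuity at 0, a prime within a factor 1 + \<eta> of n costs less than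
    \<open>d\<close> in the constant.\<close>
  have "((\<lambda>\<eta>. c / (1 + \<eta>) ^ t) \<longlongrightarrow> c / (1 + 0) ^ t) (at_right 0)" by (intro tendsto_intros) auto
  then have "\<forall>\<^sub>F \<eta> in at_right 0. c - d < c / (1 + \<eta>) ^ t" using d by (intro order_tendstoD) auto
  then have "\<forall>\<^sub>F \<eta> in at_right (0::real). c - d < c / (1 + \<eta>) ^ t \<and> 0 < \<eta>"
    using eventually_at_right_less by (rule eventually_conj)
  then obtain \<eta> where \<eta>: "c - d < c / (1 + \<eta>) ^ t" "\<eta> > 0"
    using eventually_happens trivial_limit_at_right_real by blast
  have "\<forall>\<^sub>F n in sequentially. \<exists>p. prime p \<and> n < p \<and> real p \<le> (1 + \<eta>) * real n"
    using \<eta>(2) by (intro eventually_prime_in_short_interval) simp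
  \<comment> \<open>n \<ge> s guarantees s - 1 \<le> p, hence enough colours, and n > 0.\<close>
  then show ?thesis using eventually_ge_at_top[of s]
  proof eventually_elim
    case (elim n)
    then obtain p where p: "prime p" "n < p" "real p \<le> (1 + \<eta>) * real n" by blast
    have n0: "n > 0" using elim s by simp
    have "c - d \<le> c / (1 + \<eta>) ^ t" using \<eta>(1) by simp
    also have "\<dots> = c * real n ^ t / ((1 + \<eta>) * real n) ^ t" using n0 by (simp add: power_mult_distrib)
    also have "\<dots> \<le> c * real n ^ t / real p ^ t"
      using c p(2,3) \<eta>(2) n0 by (intro divide_left_mono power_mono mult_pos_pos zero_less_power mult_nonneg_nonneg) auto
    also have "\<dots> = ((real s - 1) / ((real t + 1) * real p ^ t) * 2 ^ n) * real n ^ t / 2 ^ n"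
      by (simp add: c_def)
    also have "\<dots> \<le> real (\<alpha>\<^bsub>s\<^esub> (with_proj (hamming_graph (2 * t) n))) * real n ^ t / 2 ^ n"
      using s t elim p by (intro divide_right_mono mult_right_mono clique_free_number_ge_prime) auto
    finally show ?case by (simp only: c_def)
  qed
qed

lemma clique_free_number_lower_powers:
  fixes d :: real
  assumes s: "s \<ge> 2" and t: "t \<ge> 1" and k: "k \<ge> 1" and d: "d > 0"
  shows "\<forall>\<^sub>F m in sequentially. real s - 1 - d \<le>
     real (\<alpha>\<^bsub>s\<^esub> (with_proj (hamming_graph (2 * t) (2 ^ m - k)))) * real (2 ^ m - k) ^ t / 2 ^ (2 ^ m - k)"
proof -
  \<comment> \<open>The number of colours is (2^m)^t instead of n^t, and the ratio n / 2^m tends to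
    1 for fixed \<open>k\<close>.\<close>
  have "(\<lambda>m. (2 ^ m - real k) / 2 ^ m) \<longlonglongrightarrow> 1" by real_asymp
  then have "(\<lambda>m. (real s - 1) * ((2 ^ m - real k) / 2 ^ m) ^ t) \<longlonglongrightarrow> (real s - 1) * 1 ^ t"
    by (intro tendsto_intros)
  then have "\<forall>\<^sub>F m in sequentially. real s - 1 - d < (real s - 1) * ((2 ^ m - real k) / 2 ^ m) ^ t"
    using d by (intro order_tendstoD(1)) auto
  moreover have "\<forall>\<^sub>F m in sequentially. real (max k s) < 2 ^ m" by real_asymp
  ultimately show ?thesis using eventually_ge_at_top[of 1]
  proof eventually_elim
    case (elim m)
    then have "real (max k s) < real (2 ^ m)" by simp
    then have ks: "k < 2 ^ m" "s < 2 ^ m" by (simp_all only: of_nat_less_iff max_less_iff_conj)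
    define n where "n = 2 ^ m - k"
    have n: "real n = 2 ^ m - real k" "n < 2 ^ m" using ks(1) k by (auto simp: n_def of_nat_diff)
    have "real s - 1 - d \<le> (real s - 1) * (real n / 2 ^ m) ^ t" using elim by (simp add: n(1))
    also have "\<dots> = ((real s - 1) / (2 ^ m) ^ t * 2 ^ n) * real n ^ t / 2 ^ n"
      by (simp add: power_divide)
    also have "\<dots> \<le> real (\<alpha>\<^bsub>s\<^esub> (with_proj (hamming_graph (2 * t) n))) * real n ^ t / 2 ^ n"
      using s t elim ks n by (intro divide_right_mono mult_right_mono clique_free_number_ge_char_two) auto
    finally show ?case by (simp only: n_def)
  qed
qed

theorem theorem1p6:
  fixes s t :: nat
  assumes "s \<ge> 2" and "t \<ge> 1"
  shows "(\<exists>\<epsilon> :: nat \<Rightarrow> real. \<epsilon> \<in> o(\<lambda>_. 1) \<and>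
            (\<forall>\<^sub>F n in sequentially.
               real (\<alpha>\<^bsub>s\<^esub> (with_proj (hamming_graph (2 * t) n)))
                 \<ge> ((real s - 1) / (real t + 1) + \<epsilon> n) * (2 ^ n / real n ^ t)))
       \<and> (\<forall>k :: nat. k \<ge> 1 \<longrightarrow>
           (\<exists>\<epsilon> :: nat \<Rightarrow> real. \<epsilon> \<in> o(\<lambda>_. 1) \<and>
             (\<forall>\<^sub>F m in sequentially. \<forall>n. n = 2 ^ m - k \<longrightarrow>
                real (\<alpha>\<^bsub>s\<^esub> (with_proj (hamming_graph (2 * t) n)))
                  \<ge> (real s - 1 + \<epsilon> m) * (2 ^ n / real n ^ t))))"
proof (intro conjI allI impI)
  show "\<exists>\<epsilon> :: nat \<Rightarrow> real. \<epsilon> \<in> o(\<lambda>_. 1) \<and>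
            (\<forall>\<^sub>F n in sequentially.
               real (\<alpha>\<^bsub>s\<^esub> (with_proj (hamming_graph (2 * t) n)))
                 \<ge> ((real s - 1) / (real t + 1) + \<epsilon> n) * (2 ^ n / real n ^ t))"
    using exists_smallo_lower_bound[where N="\<lambda>n. n", OF eventually_gt_at_top clique_free_number_lower_general[OF assms]] .
  fix k :: nat assume k: "k \<ge> 1"
  \<comment> \<open>Subtraction of naturals truncates, so 2^m - k is positive only once 2^m exceeds
    k.\<close>
  have "\<forall>\<^sub>F m in sequentially. real k < 2 ^ m" by real_asymp
  then have "\<forall>\<^sub>F m in sequentially. 2 ^ m - k > 0"
  proof eventually_elim
    case (elim m)
    then have "real k < real (2 ^ m)" by simp
    then show ?case by (simp only: of_nat_less_iff zero_less_diff)
  qed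
  from exists_smallo_lower_bound[where N="\<lambda>m. 2 ^ m - k", OF this clique_free_number_lower_powers[OF assms k]]
  show "\<exists>\<epsilon> :: nat \<Rightarrow> real. \<epsilon> \<in> o(\<lambda>_. 1) \<and>
             (\<forall>\<^sub>F m in sequentially. \<forall>n. n = 2 ^ m - k \<longrightarrow>
                real (\<alpha>\<^bsub>s\<^esub> (with_proj (hamming_graph (2 * t) n)))
                  \<ge> (real s - 1 + \<epsilon> m) * (2 ^ n / real n ^ t))"
    by simp
qed

end
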